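(* Let $(\xi,\mu,\eta)$ be a linear representation over $\Sigma=\{a_1,\dots,a_\ell,b\}$ satisfying the standing assumptions in the context, assume that the matrix $M=A_1+\cdots+A_\ell+B$ is primitive, let $\lambda$ be its Perron-Frobenius eigenvalue, and let $\mathbf{Y}_n$ be the associated $\mathbb{R}^\ell$-valued symbol statistics. With the functions $y(\mathbf{t})$ and $r(\mathbf{t})$ defined in the context, there is $\varepsilon\in(0,1)$ such that, as $n\to\infty$, $$\mathbb{E}[\mathbf{Y}_n]=\boldsymbol{\beta}\,n+\mathbf{c}+O(\varepsilon^n),\qquad\text{where }\boldsymbol{\beta}=\frac{\nabla y(\mathbf{0})}{\lambda}\ \text{ and }\ \mathbf{c}=\nabla r(\mathbf{0}).$$
   Context: Model. Let $\ell\ge 1$, $m\ge 1$ be integers, $\Sigma=\{a_1,\dots,a_\ell,b\}$ a finite alphabet with $\ell+1$ symbols, $\mathbb{R}_+=[0,\infty)$. Fix column vectors $\xi,\eta\in\mathbb{R}_+^m$ and matrices $A_1,\dots,A_\ell,B\in\mathbb{R}_+^{m\times m}$. Let $\mu$ be the monoid morphism from the set $\Sigma^*$ of all words over $\Sigma$ to $\mathbb{R}_+^{m\times m}$ with $\mu(a_i)=A_i$, $\mu(b)=B$. The triple $(\xi,\mu,\eta)$ is called a linear representation. A prime on a vector or matrix denotes transposition. Put $M=A_1+\cdots+A_\ell+B$. Standing assumptions: all of $A_1,\dots,A_\ell,B$ are nonzero matrices, and for every sufficiently large $n$ there is a word $w$ of length $n$ with $\xi'\mu(w)\eta>0$ (so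 $\xi\ne 0\ne\eta$ and $\xi'M^n\eta>0$ for all large $n$). For such $n$, the set $\Sigma^n$ of words of length $n$ carries the probability measure $\Pr(w)=\dfrac{\xi'\mu(w)\eta}{\xi'M^n\eta}$, and $\mathbf{Y}_n=(|w|_{a_1},\dots,|w|_{a_\ell})$, where $w$ is random in $\Sigma^n$ with law $\Pr$ and $|w|_{x}$ is the number of occurrences of $x$ in $w$. $\mathbb{E}[\mathbf{Y}_n]$ is the vector of the means of its components. A matrix $T\in\mathbb{R}_+^{m\times m}$ is primitive if $T^k$ has all entries strictly positive for some $k\ge 1$; its Perron-Frobenius eigenvalue is its unique eigenvalue of largest modulus, which is real, positive and simple and admits strictly positive left and right eigenvectors. If $M$ is primitive then $M(\mathbf{t})=A_1e^{t_1}+\cdots+A_\ell e^{t_\ell}+B$ is primitive for all $\mathbf{t}\in\mathbb{R}^\ell$; $y(\mathbf{t})$ denotes its Perron-Frobenius eigenvalue (so $y(\mathbf{0})=\lambda$), and $v_{\mathbf{t}}'$, $u_{\mathbf{t}}$ denote strictly positive left and right eigenvectors of $M(\mathbf{t})$ for $y(\mathbf{t})$ normalized by $v_{\mathbf{t}}'u_{\mathbf{t}}=1$. Put $r(\mathbf{t})=\dfrac{\xi'u_{\mathbf{t}}v_{\mathbf{t}}'\eta}{\xi'u_{\mathbf{0}}v_{\mathbf{0}}'\eta}$. Both $y$ and $r$ are strictly positive and analytic on $\mathbb{R}^\ell$, and $r(\mathbf{0})=1$. *)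

theory Defs
  imports "HOL-Analysis.Analysis" "HOL-Library.Landau_Symbols"
begin

text \<open>
  The finite types \<open>'l\<close> and \<open>'m\<close> index the letters $a_1,\dots,a_\ell$ and the vector
  coordinates; their cardinalities $\ell$ and $m$ are arbitrary positive integers.
\<close>

datatype 'l letter = LetA 'l | LetB

definition nonneg_mat :: "real ^ 'n ^ 'm \<Rightarrow> bool" where
  "nonneg_mat T \<longleftrightarrow> (\<forall>i j. 0 \<le> T $ i $ j)"

primrec mat_pow :: "real ^ 'm ^ 'm \<Rightarrow> nat \<Rightarrow> real ^ 'm ^ 'm" where
  "mat_pow T 0 = mat 1"
| "mat_pow T (Suc k) = T ** mat_pow T k"

definition primitive_mat :: "real ^ 'm ^ 'm \<Rightarrow> bool" where
  "primitive_mat T \<longleftrightarrow> nonneg_mat T \<and> (\<exists>k\<ge>1. \<forall>i j. 0 < mat_pow T k $ i $ j)"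


subsection \<open>Perron-Frobenius eigenvalue and eigenvectors\<close>

definition complex_eigenvalue :: "real ^ 'm ^ 'm \<Rightarrow> complex \<Rightarrow> bool" where
  "complex_eigenvalue T z \<longleftrightarrow>
     (\<exists>x :: complex ^ 'm. x \<noteq> 0 \<and> map_matrix complex_of_real T *v x = z *s x)"

definition pf_eigenvalue :: "real ^ 'm ^ 'm \<Rightarrow> real" where
  "pf_eigenvalue T = (THE \<rho>. complex_eigenvalue T (complex_of_real \<rho>) \<and>
     (\<forall>z. complex_eigenvalue T z \<and> z \<noteq> complex_of_real \<rho> \<longrightarrow>
        cmod z < cmod (complex_of_real \<rho>)))"

definition pf_vectors :: "real ^ 'm ^ 'm \<Rightarrow> real ^ 'm \<Rightarrow> real ^ 'm \<Rightarrow> bool" where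
  "pf_vectors T v u \<longleftrightarrow>
     (\<forall>i. 0 < v $ i) \<and> (\<forall>i. 0 < u $ i) \<and>
     v v* T = pf_eigenvalue T *s v \<and> T *v u = pf_eigenvalue T *s u \<and> v \<bullet> u = 1"

text \<open>
  For primitive \<open>T\<close> the pair $(v,u)$ is unique up to replacing it by $(v/c, cu)$ with $c > 0$, so
  $u v'$, which is all that is used below, does not depend on the choice.
\<close>

definition pf_pair :: "real ^ 'm ^ 'm \<Rightarrow> (real ^ 'm) \<times> (real ^ 'm)" where
  "pf_pair T = (SOME (v, u). pf_vectors T v u)"

definition pf_left :: "real ^ 'm ^ 'm \<Rightarrow> real ^ 'm" where
  "pf_left T = fst (pf_pair T)"

definition pf_right :: "real ^ 'm ^ 'm \<Rightarrow> real ^ 'm" where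
  "pf_right T = snd (pf_pair T)"


subsection \<open>Linear representations and symbol statistics\<close>

primrec letter_mat :: "('l \<Rightarrow> real ^ 'm ^ 'm) \<Rightarrow> real ^ 'm ^ 'm \<Rightarrow> 'l letter \<Rightarrow> real ^ 'm ^ 'm" where
  "letter_mat A B (LetA i) = A i"
| "letter_mat A B LetB = B"

primrec word_mat ::
  "('l \<Rightarrow> real ^ 'm ^ 'm) \<Rightarrow> real ^ 'm ^ 'm \<Rightarrow> 'l letter list \<Rightarrow> real ^ 'm ^ 'm" where
  "word_mat A B [] = mat 1"
| "word_mat A B (x # w) = letter_mat A B x ** word_mat A B w"

definition total_mat :: "('l::finite \<Rightarrow> real ^ 'm ^ 'm) \<Rightarrow> real ^ 'm ^ 'm \<Rightarrow> real ^ 'm ^ 'm" where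
  "total_mat A B = (\<Sum>i\<in>UNIV. A i) + B"

definition linear_representation ::
  "real ^ 'm \<Rightarrow> ('l::finite \<Rightarrow> real ^ 'm ^ 'm) \<Rightarrow> real ^ 'm ^ 'm \<Rightarrow> real ^ 'm \<Rightarrow> bool" where
  "linear_representation \<xi> A B \<eta> \<longleftrightarrow>
     (\<forall>i. 0 \<le> \<xi> $ i) \<and> (\<forall>i. 0 \<le> \<eta> $ i) \<and> (\<forall>i. nonneg_mat (A i)) \<and> nonneg_mat B"

text \<open>
  The law $\Pr$ on words of length \<open>n\<close>. It is a probability measure whenever the denominator is
  positive, which the standing assumptions guarantee for all large \<open>n\<close>.
\<close>

definition word_measure ::
  "real ^ 'm \<Rightarrow> ('l::finite \<Rightarrow> real ^ 'm ^ 'm) \<Rightarrow> real ^ 'm ^ 'm \<Rightarrow> real ^ 'm \<Rightarrow> nat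
     \<Rightarrow> 'l letter list measure" where
  "word_measure \<xi> A B \<eta> n = point_measure {w. length w = n}
     (\<lambda>w. ennreal ((\<xi> \<bullet> (word_mat A B w *v \<eta>)) / (\<xi> \<bullet> (mat_pow (total_mat A B) n *v \<eta>))))"

definition symbol_counts :: "'l letter list \<Rightarrow> real ^ 'l" where
  "symbol_counts w = (\<chi> i. real (count_list w (LetA i)))"

definition mean_counts ::
  "real ^ 'm \<Rightarrow> ('l::finite \<Rightarrow> real ^ 'm ^ 'm) \<Rightarrow> real ^ 'm ^ 'm \<Rightarrow> real ^ 'm \<Rightarrow> nat \<Rightarrow> real ^ 'l" where
  "mean_counts \<xi> A B \<eta> n = (\<chi> i. LINT w|word_measure \<xi> A B \<eta> n. symbol_counts w $ i)"


subsection \<open>The functions $y$ and $r$ and their gradients\<close>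

definition tilted_mat ::
  "('l::finite \<Rightarrow> real ^ 'm ^ 'm) \<Rightarrow> real ^ 'm ^ 'm \<Rightarrow> real ^ 'l \<Rightarrow> real ^ 'm ^ 'm" where
  "tilted_mat A B t = (\<Sum>i\<in>UNIV. exp (t $ i) *\<^sub>R A i) + B"

definition y_fun :: "('l::finite \<Rightarrow> real ^ 'm ^ 'm) \<Rightarrow> real ^ 'm ^ 'm \<Rightarrow> real ^ 'l \<Rightarrow> real" where
  "y_fun A B t = pf_eigenvalue (tilted_mat A B t)"

definition r_fun ::
  "real ^ 'm \<Rightarrow> ('l::finite \<Rightarrow> real ^ 'm ^ 'm) \<Rightarrow> real ^ 'm ^ 'm \<Rightarrow> real ^ 'm \<Rightarrow> real ^ 'l \<Rightarrow> real" where
  "r_fun \<xi> A B \<eta> t =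
     ((\<xi> \<bullet> pf_right (tilted_mat A B t)) * (pf_left (tilted_mat A B t) \<bullet> \<eta>)) /
     ((\<xi> \<bullet> pf_right (tilted_mat A B 0)) * (pf_left (tilted_mat A B 0) \<bullet> \<eta>))"

definition gradient :: "('a::real_inner \<Rightarrow> real) \<Rightarrow> 'a \<Rightarrow> 'a" where
  "gradient f x = (THE D. GDERIV f x :> D)"

end

theory Submission
  imports Defs
begin

text \<open>
  Write \<open>M\<close> for the total matrix, \<open>\<lambda>\<close> for its Perron-Frobenius eigenvalue with
  eigenvectors \<open>u\<close>, \<open>v'\<close>, and \<open>S\<close> for the reduced resolvent: \<open>S u = 0\<close>,
  \<open>v' S = 0\<close> and \<open>(\<lambda> - M) S = S (\<lambda> - M) = I - u v'\<close>. Then \<open>M\<^sup>n = \<lambda>\<^sup>n (u v' + D\<^sub>n)\<close>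
  with \<open>D\<^sub>n\<close> geometrically small and \<open>\<Sum>\<^sub>n D\<^sub>n = \<lambda> S\<close>. The mean number of
  letters \<open>a\<^sub>i\<close> is \<open>\<Sum>\<^sub>k \<xi>' M\<^sup>k A\<^sub>i M\<^sup>n\<^sup>-\<^sup>1\<^sup>-\<^sup>k \<eta>\<close> divided by \<open>\<xi>' M\<^sup>n \<eta>\<close>;
  expanding both powers gives the slope \<open>v' A\<^sub>i u / \<lambda>\<close> and the constant
  \<open>\<xi>' (u v' A\<^sub>i S + S A\<^sub>i u v') \<eta> / (\<xi>' u v' \<eta>)\<close> up to an error of order \<open>n \<delta>\<^sup>n\<close>.
  First-order perturbation theory identifies \<open>v' A\<^sub>i u\<close> and \<open>u v' A\<^sub>i S + S A\<^sub>i u v'\<close> as the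
  partial derivatives of the eigenvalue and of the spectral projection of the tilted matrix.
\<close>

section \<open>Primitive matrices\<close>

lemma mat_pow_commute: "mat_pow T k ** T = T ** mat_pow T k"
  by (induction k) (simp_all flip: matrix_mul_assoc)

lemma mat_pow_transpose: "mat_pow (transpose T) k = transpose (mat_pow T k)"
  by (induction k) (simp_all add: matrix_transpose_mul flip: mat_pow_commute)

lemma mat_pow_add: "mat_pow T (j + k) = mat_pow T j ** mat_pow T k"
  by (induction j) (simp_all add: matrix_mul_assoc)

lemma mat_pow_eigenvector:
  fixes T :: "real ^ 'm ^ 'm"
  assumes "T *v x = r *s x"
  shows "mat_pow T k *v x = r ^ k *s x"
proof (induction k)
  case (Suc k)
  have "mat_pow T (Suc k) *v x = T *v (mat_pow T k *v x)"
    by (simp add: matrix_vector_mul_assoc)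
  also have "\<dots> = r ^ Suc k *s x"
    by (simp add: Suc assms vector_scalar_commute vec_eq_iff mult_ac)
  finally show ?case .
qed simp

lemma mat_pow_left_eigenvector:
  fixes T :: "real ^ 'm ^ 'm"
  assumes "v v* T = r *s v"
  shows "v v* mat_pow T k = r ^ k *s v"
  using mat_pow_eigenvector[of "transpose T" v r k] assms by (simp add: mat_pow_transpose)

lemma nonneg_mat_pow: "nonneg_mat T \<Longrightarrow> nonneg_mat (mat_pow T k)"
  by (induction k) (auto simp: nonneg_mat_def mat_def matrix_matrix_mult_def intro!: sum_nonneg)

lemma primitive_mat_transpose:
  assumes "primitive_mat T"
  shows "primitive_mat (transpose T)"
proof -
  have "nonneg_mat (transpose T)"
    using assms by (simp add: primitive_mat_def nonneg_mat_def transpose_def)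
  moreover obtain k where "k \<ge> 1" "\<forall>i j. 0 < mat_pow T k $ i $ j"
    using assms by (auto simp: primitive_mat_def)
  then have "\<forall>i j. 0 < mat_pow (transpose T) k $ i $ j"
    by (simp add: mat_pow_transpose) (simp add: transpose_def)
  ultimately show ?thesis
    using \<open>k \<ge> 1\<close> unfolding primitive_mat_def by blast
qed

text \<open>Entrywise domination passes to powers of nonnegative matrices, so a strictly positive
  power of \<open>T\<close> makes the same power of \<open>S\<close> strictly positive. This
  transfers primitivity from \<open>M\<close> to the tilted matrices.\<close>

lemma primitive_mat_dominated:
  assumes T: "primitive_mat T" and c: "0 < c" and le: "\<And>i j. c * T $ i $ j \<le> S $ i $ j"
  shows "primitive_mat S"
proof -
  have T0: "nonneg_mat T"
    using T by (simp add: primitive_mat_def)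
  have S0: "nonneg_mat S"
    unfolding nonneg_mat_def
    by (metis T0 c le less_imp_le mult_nonneg_nonneg nonneg_mat_def order_trans)
  have pow: "c ^ k * mat_pow T k $ i $ j \<le> mat_pow S k $ i $ j" for k i j
  proof (induction k arbitrary: i j)
    case (Suc k)
    have "c ^ Suc k * mat_pow T (Suc k) $ i $ j = (\<Sum>l\<in>UNIV. (c * T $ i $ l) * (c ^ k * mat_pow T k $ l $ j))"
      by (simp add: matrix_matrix_mult_def sum_distrib_left mult_ac)
    also have "\<dots> \<le> (\<Sum>l\<in>UNIV. S $ i $ l * mat_pow S k $ l $ j)"
      using nonneg_mat_pow[OF T0, of k] S0 c
      by (intro sum_mono mult_mono le Suc) (auto simp: nonneg_mat_def)
    finally show ?case
      by (simp add: matrix_matrix_mult_def)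
  qed simp
  obtain k where k: "k \<ge> 1" "\<And>i j. 0 < mat_pow T k $ i $ j"
    using T by (auto simp: primitive_mat_def)
  have "0 < mat_pow S k $ i $ j" for i j
    using pow[of k i j] k(2)[of i j] c by (smt (verit) mult_pos_pos zero_less_power)
  with S0 k(1) show ?thesis
    unfolding primitive_mat_def by blast
qed

text \<open>Brouwer's theorem is applied on the standard simplex to \<open>x\<close> mapped to
  \<open>T x\<close> divided by its coordinate sum. A fixed point is a nonnegative eigenvector, and
  a positive power of \<open>T\<close> makes it strictly positive.\<close>

lemma primitive_mat_positive_eigenvector:
  fixes T :: "real ^ 'm ^ 'm"
  assumes "primitive_mat T"
  obtains r u where "0 < r" "\<And>i. 0 < u $ i" "T *v u = r *s u"
proof -
  have T0: "0 \<le> T $ i $ j" for i j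
    using assms by (simp add: primitive_mat_def nonneg_mat_def)
  obtain k where "k \<ge> 1" and pos: "\<And>i j. 0 < mat_pow T k $ i $ j"
    using assms by (auto simp: primitive_mat_def)
  then obtain k' where k': "k = Suc k'"
    by (cases k) auto
  define S where "S = {x :: real ^ 'm. (\<forall>i. 0 \<le> x $ i) \<and> (\<Sum>i\<in>UNIV. x $ i) = 1}"
  define s where "s x = (\<Sum>i\<in>UNIV. (T *v x) $ i)" for x
  define f where "f x = (1 / s x) *\<^sub>R (T *v x)" for x
  have Tx0: "0 \<le> (T *v x) $ i" if "x \<in> S" for x i
    using that T0 by (auto simp: S_def matrix_vector_mult_def intro!: sum_nonneg)
  have pow_pos: "0 < (mat_pow T k *v x) $ i" if "x \<in> S" for x i
  proof -
    have "(\<Sum>j\<in>UNIV. x $ j) \<noteq> 0"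
      using that by (simp add: S_def)
    then have "\<not> (\<forall>j. x $ j = 0)"
      by (metis sum.neutral)
    then obtain j where "x $ j \<noteq> 0"
      by blast
    then have "0 < x $ j"
      using that by (simp add: S_def less_le)
    then have "0 < mat_pow T k $ i $ j * x $ j"
      using pos by simp
    also have "\<dots> \<le> (\<Sum>j\<in>UNIV. mat_pow T k $ i $ j * x $ j)"
      using that
      by (intro member_le_sum) (auto simp: S_def intro!: mult_nonneg_nonneg less_imp_le[OF pos])
    finally show ?thesis
      by (simp add: matrix_vector_mult_def)
  qed
  \<comment> \<open>The normalisation never divides by zero: since \<open>k\<close> is at least 1,
    \<open>T x = 0\<close> would force the \<open>k\<close>-th power of \<open>T\<close> to
    annihilate \<open>x\<close> as well.\<close>
  have s_pos: "0 < s x" if "x \<in> S" for x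
  proof -
    have "s x \<noteq> 0"
    proof
      assume "s x = 0"
      then have "T *v x = 0"
        using Tx0[OF that] by (simp add: s_def sum_nonneg_eq_0_iff vec_eq_iff)
      moreover have "mat_pow T k *v x = mat_pow T k' *v (T *v x)"
        by (simp add: k' matrix_vector_mul_assoc mat_pow_commute)
      ultimately show False
        using pow_pos[OF that] by simp
    qed
    moreover have "0 \<le> s x"
      using Tx0[OF that] by (simp add: s_def sum_nonneg)
    ultimately show ?thesis by simp
  qed
  have "compact S"
  proof (rule compact_eq_bounded_closed[THEN iffD2, OF conjI])
    have "norm x \<le> 1" if "x \<in> S" for x
      using norm_le_l1_cart[of x] that by (simp add: S_def)
    then show "bounded S"
      unfolding bounded_iff by blast
    show "closed S"
      unfolding S_def
      by (intro closed_Collect_conj closed_Collect_all closed_Collect_le closed_Collect_eq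
          continuous_intros)
  qed
  moreover have "convex S"
    by (auto simp: convex_def S_def sum.distrib simp flip: sum_distrib_left)
  moreover have "S \<noteq> {}"
  proof -
    have "axis undefined 1 \<in> S"
      by (simp add: S_def axis_def)
    then show ?thesis by blast
  qed
  moreover have "continuous_on S f"
  proof -
    have "continuous_on S (\<lambda>x. T *v x)"
      by (intro linear_continuous_on matrix_vector_mul_bounded_linear)
    then show ?thesis
      unfolding f_def s_def
      using s_pos by (intro continuous_intros) (auto simp: s_def less_le)
  qed
  moreover have "f \<in> S \<rightarrow> S"
  proof
    fix x assume x: "x \<in> S"
    have "(\<Sum>i\<in>UNIV. f x $ i) = (1 / s x) * s x"
      by (simp add: f_def s_def flip: sum_divide_distrib)
    then show "f x \<in> S"
      using s_pos[OF x] Tx0[OF x] by (simp add: S_def f_def)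
  qed
  ultimately obtain x where x: "x \<in> S" "f x = x"
    using brouwer by blast
  have eig: "T *v x = s x *s x"
    using x(2) s_pos[OF x(1)] by (auto simp: f_def scalar_mult_eq_scaleR)
      (metis divideR_right less_irrefl inverse_eq_divide)
  \<comment> \<open>The strictly positive vector \<open>mat_pow T k *v x\<close> is the multiple
    \<open>s x ^ k\<close> of \<open>x\<close>.\<close>
  have "0 < x $ i" for i
    using pow_pos[OF x(1), of i] s_pos[OF x(1)] by (simp add: mat_pow_eigenvector[OF eig] zero_less_mult_iff)
  with eig s_pos[OF x(1)] show ?thesis
    by (intro that)
qed

lemma inner_pos_vec:
  fixes u v :: "real ^ 'm"
  assumes "\<And>i. 0 < u $ i" "\<And>i. 0 < v $ i"
  shows "0 < v \<bullet> u"
  using assms by (auto simp: inner_vec_def intro!: sum_pos)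

text \<open>A left eigenvector is a right eigenvector of the transpose. Its eigenvalue agrees with
  that of \<open>u\<close> because \<open>v' T u\<close> can be evaluated from either side and
  \<open>v' u\<close> is positive.\<close>

lemma primitive_mat_eigenpair:
  fixes T :: "real ^ 'm ^ 'm"
  assumes "primitive_mat T"
  obtains r u v where "0 < r" "\<And>i. 0 < u $ i" "\<And>i. 0 < v $ i"
    "T *v u = r *s u" "v v* T = r *s v" "v \<bullet> u = 1"
proof -
  obtain r u where u: "0 < r" "\<And>i. 0 < u $ i" "T *v u = r *s u"
    using primitive_mat_positive_eigenvector[OF assms] by metis
  obtain r' v where v: "0 < r'" "\<And>i. 0 < v $ i" "v v* T = r' *s v"
    using primitive_mat_positive_eigenvector[OF primitive_mat_transpose[OF assms]]
    by (metis transpose_matrix_vector)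
  have pos: "0 < v \<bullet> u"
    by (rule inner_pos_vec[OF u(2) v(2)])
  have "r' * (v \<bullet> u) = r * (v \<bullet> u)"
    using dot_lmul_matrix[of v T u] by (simp add: u(3) v(3) scalar_mult_eq_scaleR)
  then have "r' = r" using pos by simp
  show ?thesis
  proof (rule that[of r u "(1 / (v \<bullet> u)) *s v"])
    show "((1 / (v \<bullet> u)) *s v) v* T = r *s ((1 / (v \<bullet> u)) *s v)"
      by (simp add: scalar_vector_matrix_assoc v(3) \<open>r' = r\<close> vec_eq_iff)
    show "((1 / (v \<bullet> u)) *s v) \<bullet> u = 1"
      using pos by (simp add: scalar_mult_eq_scaleR)
  qed (use u v pos in auto)
qed

text \<open>
  After subtracting \<open>\<epsilon> u v'\<close>, which acts as zero on the kernel of \<open>v'\<close>, the matrix is still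
  nonnegative. The type \<open>'b\<close> allows both real and complex vectors.
\<close>

lemma weighted_sum_contraction:
  fixes W :: "real ^ 'm ^ 'm" and x :: "'m \<Rightarrow> 'b::real_normed_vector"
  assumes v: "\<And>i. 0 \<le> v $ i" and vu: "v \<bullet> u = 1" and vW: "v v* W = r *s v"
    and W: "\<And>i j. e * (u $ i * v $ j) \<le> W $ i $ j"
    and x: "(\<Sum>j\<in>UNIV. v $ j *\<^sub>R x j) = 0"
  shows "(\<Sum>i\<in>UNIV. v $ i * norm (\<Sum>j\<in>UNIV. W $ i $ j *\<^sub>R x j))
           \<le> (r - e) * (\<Sum>j\<in>UNIV. v $ j * norm (x j))"
proof -
  have "norm (\<Sum>j\<in>UNIV. W $ i $ j *\<^sub>R x j) \<le> (\<Sum>j\<in>UNIV. (W $ i $ j - e * (u $ i * v $ j)) * norm (x j))" for i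
  proof -
    have "(\<Sum>j\<in>UNIV. W $ i $ j *\<^sub>R x j)
        = (\<Sum>j\<in>UNIV. (W $ i $ j - e * (u $ i * v $ j)) *\<^sub>R x j) + (e * u $ i) *\<^sub>R (\<Sum>j\<in>UNIV. v $ j *\<^sub>R x j)"
      by (simp add: scaleR_sum_right algebra_simps flip: sum.distrib)
    also have "norm \<dots> \<le> (\<Sum>j\<in>UNIV. norm ((W $ i $ j - e * (u $ i * v $ j)) *\<^sub>R x j))"
      unfolding x by (simp only: scaleR_zero_right add_0_right norm_sum)
    also have "\<dots> = (\<Sum>j\<in>UNIV. (W $ i $ j - e * (u $ i * v $ j)) * norm (x j))"
      using W[of i] by (intro sum.cong refl) simp
    finally show ?thesis .
  qed
  then have "(\<Sum>i\<in>UNIV. v $ i * norm (\<Sum>j\<in>UNIV. W $ i $ j *\<^sub>R x j))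
      \<le> (\<Sum>i\<in>UNIV. v $ i * (\<Sum>j\<in>UNIV. (W $ i $ j - e * (u $ i * v $ j)) * norm (x j)))"
    by (intro sum_mono mult_left_mono v)
  also have "\<dots> = (\<Sum>j\<in>UNIV. (\<Sum>i\<in>UNIV. v $ i * (W $ i $ j - e * (u $ i * v $ j))) * norm (x j))"
    unfolding sum_distrib_left sum_distrib_right by (subst sum.swap) (simp add: mult_ac)
  also have "\<dots> = (\<Sum>j\<in>UNIV. ((r - e) * v $ j) * norm (x j))"
  proof (intro sum.cong refl arg_cong[where f = "\<lambda>z. z * _"])
    fix j
    have "(\<Sum>i\<in>UNIV. v $ i * (W $ i $ j - e * (u $ i * v $ j))) = (v v* W) $ j - e * (v \<bullet> u) * v $ j"
      by (simp add: vector_matrix_mult_def inner_vec_def algebra_simps sum_subtractf sum_distrib_left sum_distrib_right)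
    then show "(\<Sum>i\<in>UNIV. v $ i * (W $ i $ j - e * (u $ i * v $ j))) = (r - e) * v $ j"
      by (simp add: vW vu algebra_simps)
  qed
  finally show ?thesis
    by (simp add: sum_distrib_left mult_ac)
qed

text \<open>The constant is the least of the finitely many ratios between the entries of
  \<open>W\<close> and of \<open>u v'\<close>. It is the \<open>e\<close> required by the
  contraction estimate.\<close>

lemma positive_mat_rank_one_minorant:
  fixes W :: "real ^ 'm ^ 'm"
  assumes "\<And>i j. 0 < W $ i $ j" "\<And>i. 0 < u $ i" "\<And>i. 0 < v $ i"
  obtains e where "0 < e" "\<And>i j. e * (u $ i * v $ j) \<le> W $ i $ j"
proof -
  define F where "F = (\<lambda>(i, j). W $ i $ j / (u $ i * v $ j)) ` UNIV"
  have F: "finite F" "F \<noteq> {}"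
    by (auto simp: F_def)
  have "0 < Min F"
    using F assms by (auto simp: F_def)
  moreover have "Min F * (u $ i * v $ j) \<le> W $ i $ j" for i j
  proof -
    have "Min F \<le> W $ i $ j / (u $ i * v $ j)"
      using F(1) by (intro Min_le) (auto simp: F_def)
    then show ?thesis
      using assms by (simp add: pos_le_divide_eq)
  qed
  ultimately show ?thesis
    by (rule that)
qed

text \<open>An eigenvector \<open>x\<close> for any other complex eigenvalue \<open>z\<close> is
  annihilated by \<open>v'\<close>. There the \<open>k\<close>-th power of \<open>T\<close>
  contracts the weighted norm by the factor \<open>r ^ k - e\<close>, so
  \<open>|z| ^ k < r ^ k\<close>. Thus \<open>r\<close> is strictly dominant, and only one
  eigenvalue can be.\<close>

lemma pf_eigenvalue_eqI:
  fixes T :: "real ^ 'm ^ 'm"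
  assumes T: "primitive_mat T" and r: "0 < r" and u: "\<And>i. 0 < u $ i" and v: "\<And>i. 0 < v $ i"
    and Tu: "T *v u = r *s u" and vT: "v v* T = r *s v" and vu: "v \<bullet> u = 1"
  shows "pf_eigenvalue T = r"
proof -
  obtain k where k: "k \<ge> 1" "\<And>i j. 0 < mat_pow T k $ i $ j"
    using T by (auto simp: primitive_mat_def)
  obtain e where e: "0 < e" "\<And>i j. e * (u $ i * v $ j) \<le> mat_pow T k $ i $ j"
    using positive_mat_rank_one_minorant[OF k(2) u v] by blast
  have eig: "complex_eigenvalue T (of_real r)"
    unfolding complex_eigenvalue_def
  proof (intro exI conjI)
    show "(\<chi> i. complex_of_real (u $ i)) \<noteq> 0"
      using u by (auto simp: vec_eq_iff less_le)
    show "map_matrix complex_of_real T *v (\<chi> i. complex_of_real (u $ i))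
        = complex_of_real r *s (\<chi> i. complex_of_real (u $ i))"
      using Tu by (simp add: vec_eq_iff matrix_vector_mult_def flip: of_real_mult of_real_sum)
  qed
  have dom: "cmod z < r" if z: "complex_eigenvalue T z" "z \<noteq> of_real r" for z
  proof -
    obtain x :: "complex ^ 'm" where x: "x \<noteq> 0" "map_matrix complex_of_real T *v x = z *s x"
      using z(1) by (auto simp: complex_eigenvalue_def)
    have Tx: "(\<Sum>j\<in>UNIV. T $ i $ j *\<^sub>R x $ j) = z * x $ i" for i
      using x(2) by (simp add: vec_eq_iff matrix_vector_mult_def scaleR_conv_of_real)
    have pow: "(\<Sum>j\<in>UNIV. mat_pow T n $ i $ j *\<^sub>R x $ j) = z ^ n * x $ i" for n i
    proof (induction n arbitrary: i)
      case 0
      then show ?case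
        by (simp add: mat_def if_distrib[of "\<lambda>c. c *\<^sub>R _"] cong: if_cong)
    next
      case (Suc n)
      have "(\<Sum>j\<in>UNIV. mat_pow T (Suc n) $ i $ j *\<^sub>R x $ j)
          = (\<Sum>l\<in>UNIV. T $ i $ l *\<^sub>R (\<Sum>j\<in>UNIV. mat_pow T n $ l $ j *\<^sub>R x $ j))"
        by (simp add: matrix_matrix_mult_def scaleR_sum_left scaleR_sum_right) (rule sum.swap)
      also have "\<dots> = z ^ n * (\<Sum>l\<in>UNIV. T $ i $ l *\<^sub>R x $ l)"
        by (simp add: Suc sum_distrib_left)
      finally show ?case
        by (simp add: Tx mult_ac)
    qed
    \<comment> \<open>Evaluating \<open>v' T x\<close> from both sides gives
      \<open>z v' x = r v' x\<close>, hence \<open>v' x = 0\<close> because \<open>z\<close> differs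
      from \<open>r\<close>.\<close>
    have "z * (\<Sum>i\<in>UNIV. v $ i *\<^sub>R x $ i) = (\<Sum>i\<in>UNIV. v $ i *\<^sub>R (\<Sum>j\<in>UNIV. T $ i $ j *\<^sub>R x $ j))"
      by (simp add: Tx sum_distrib_left)
    also have "\<dots> = (\<Sum>j\<in>UNIV. (v v* T) $ j *\<^sub>R x $ j)"
      by (simp add: vector_matrix_mult_def scaleR_sum_left scaleR_sum_right mult.commute) (rule sum.swap)
    also have "\<dots> = of_real r * (\<Sum>i\<in>UNIV. v $ i *\<^sub>R x $ i)"
      by (simp add: vT scaleR_conv_of_real sum_distrib_left mult_ac)
    finally have vx: "(\<Sum>i\<in>UNIV. v $ i *\<^sub>R x $ i) = 0"
      using z(2) by simp
    let ?s = "\<Sum>i\<in>UNIV. v $ i * norm (x $ i)"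
    have "0 < ?s"
    proof -
      obtain i where "x $ i \<noteq> 0"
        using x(1) by (auto simp: vec_eq_iff)
      then show ?thesis
        using v by (intro sum_pos2[of _ i]) (auto intro!: mult_nonneg_nonneg less_imp_le[OF v])
    qed
    moreover have "cmod z ^ k * ?s \<le> (r ^ k - e) * ?s"
    proof -
      have "(\<Sum>i\<in>UNIV. v $ i * norm (\<Sum>j\<in>UNIV. mat_pow T k $ i $ j *\<^sub>R x $ j)) \<le> (r ^ k - e) * ?s"
        using less_imp_le[OF v] vu mat_pow_left_eigenvector[OF vT] e(2) vx
        by (rule weighted_sum_contraction)
      then show ?thesis
        by (simp add: pow norm_mult norm_power sum_distrib_left mult_ac)
    qed
    ultimately have "cmod z ^ k < r ^ k"
      using e(1) by auto
    then show ?thesis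
      using r by (metis less_imp_le power_less_imp_less_base)
  qed
  show ?thesis
    unfolding pf_eigenvalue_def
  proof (rule the_equality)
    show "complex_eigenvalue T (complex_of_real r) \<and>
      (\<forall>z. complex_eigenvalue T z \<and> z \<noteq> complex_of_real r \<longrightarrow> cmod z < cmod (complex_of_real r))"
      using eig dom r by auto
  next
    fix q
    assume q: "complex_eigenvalue T (complex_of_real q) \<and>
      (\<forall>z. complex_eigenvalue T z \<and> z \<noteq> complex_of_real q \<longrightarrow> cmod z < cmod (complex_of_real q))"
    show "q = r"
    proof (rule ccontr)
      assume "q \<noteq> r"
      then have "cmod (of_real q) < r"
        using dom[of "of_real q"] q by auto
      moreover have "cmod (of_real r) < cmod (of_real q)"
        using q eig \<open>q \<noteq> r\<close> by (metis of_real_eq_iff)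
      ultimately show False by simp
    qed
  qed
qed

text \<open>Existence of an eigenpair, together with the identification of its eigenvalue,
  discharges the description and choice operators in the definitions.\<close>

lemma pf_pair_primitive:
  fixes T :: "real ^ 'm ^ 'm"
  assumes "primitive_mat T"
  shows "0 < pf_eigenvalue T" "pf_vectors T (pf_left T) (pf_right T)"
proof -
  obtain r u v where *: "0 < r" "\<And>i. 0 < u $ i" "\<And>i. 0 < v $ i"
    "T *v u = r *s u" "v v* T = r *s v" "v \<bullet> u = 1"
    using primitive_mat_eigenpair[OF assms] by metis
  have r: "pf_eigenvalue T = r"
    by (rule pf_eigenvalue_eqI[OF assms *])
  show "0 < pf_eigenvalue T"
    using *(1) r by simp
  have "case (v, u) of (v, u) \<Rightarrow> pf_vectors T v u"
    using * r by (simp add: pf_vectors_def)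
  then have "case pf_pair T of (v, u) \<Rightarrow> pf_vectors T v u"
    unfolding pf_pair_def by (rule someI)
  then show "pf_vectors T (pf_left T) (pf_right T)"
    by (simp add: pf_left_def pf_right_def split_beta)
qed

section \<open>Spectral gap and reduced resolvent\<close>

lemma pf_vectorsD:
  assumes "pf_vectors T v u"
  shows "0 < u $ i" "0 < v $ i" "T *v u = pf_eigenvalue T *\<^sub>R u"
    "v v* T = pf_eigenvalue T *\<^sub>R v" "v \<bullet> u = 1" "v \<bullet> (T *v x) = pf_eigenvalue T * (v \<bullet> x)"
  using assms dot_lmul_matrix[of v T x] by (auto simp: pf_vectors_def scalar_mult_eq_scaleR)

lemma pf_vectors_transpose:
  assumes "primitive_mat T" "pf_vectors T v u"
  shows "pf_eigenvalue (transpose T) = pf_eigenvalue T" "pf_vectors (transpose T) u v"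
proof -
  show *: "pf_eigenvalue (transpose T) = pf_eigenvalue T"
    using assms(2) pf_pair_primitive(1)[OF assms(1)]
    by (intro pf_eigenvalue_eqI[where u = v and v = u] primitive_mat_transpose assms(1))
      (auto simp: pf_vectors_def inner_commute)
  show "pf_vectors (transpose T) u v"
    using assms(2) by (simp add: pf_vectors_def * inner_commute)
qed

text \<open>The kernel of \<open>v'\<close> is invariant under \<open>T\<close>, and on it
  \<open>k\<close> steps contract the weighted norm \<open>w\<close> by \<open>r ^ k - e\<close>.
  Iterating gives geometric decay relative to \<open>r ^ n\<close>, and \<open>w\<close> is
  equivalent to the Euclidean norm.\<close>

lemma mat_pow_decay_on_kernel:
  fixes T :: "real ^ 'm ^ 'm"
  assumes T: "primitive_mat T" and vu: "pf_vectors T v u"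
  obtains d C where "0 < d" "d < 1" "0 \<le> C"
    "\<And>n x. v \<bullet> x = 0 \<Longrightarrow> norm (mat_pow T n *v x) \<le> C * (pf_eigenvalue T * d) ^ n * norm x"
proof -
  define r where "r = pf_eigenvalue T"
  have r: "0 < r"
    unfolding r_def by (rule pf_pair_primitive(1)[OF T])
  note vu = pf_vectorsD[OF vu, folded r_def]
  have T0: "0 \<le> T $ i $ j" for i j
    using T by (simp add: primitive_mat_def nonneg_mat_def)
  obtain k where k: "k \<ge> 1" "\<And>i j. 0 < mat_pow T k $ i $ j"
    using T by (auto simp: primitive_mat_def)
  obtain e where e: "0 < e" "\<And>i j. e * (u $ i * v $ j) \<le> mat_pow T k $ i $ j"
    using positive_mat_rank_one_minorant[OF k(2) vu(1) vu(2)] by blast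
  define w where "w x = (\<Sum>i\<in>UNIV. v $ i * \<bar>x $ i\<bar>)" for x
  have w0: "0 \<le> w x" for x
    unfolding w_def by (intro sum_nonneg mult_nonneg_nonneg less_imp_le[OF vu(2)]) simp
  have contr: "w (W *v x) \<le> (q - e') * w x"
    if "v \<bullet> x = 0" "v v* W = q *\<^sub>R v" "\<And>i j. e' * (u $ i * v $ j) \<le> W $ i $ j" for W q e' x
    using weighted_sum_contraction[of v u W q e' "\<lambda>j. x $ j"] that less_imp_le[OF vu(2)] vu(5)
    by (simp add: w_def matrix_vector_mult_def inner_vec_def scalar_mult_eq_scaleR)
  have pow0: "v \<bullet> (mat_pow T n *v x) = 0" if "v \<bullet> x = 0" for n x
    using mat_pow_left_eigenvector[of v T r n] dot_lmul_matrix[of v "mat_pow T n" x] that vu(4)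
    by (simp add: scalar_mult_eq_scaleR)
  \<comment> \<open>The maximum with \<open>1 / 2\<close> keeps \<open>q\<close> positive even when
    \<open>e = r ^ k\<close>; the \<open>k\<close>-th root spreads the gain of \<open>k\<close>
    steps evenly over single steps.\<close>
  define q where "q = max (1 / 2) (1 - e / r ^ k)"
  define d where "d = root k q"
  have q: "0 < q" "q < 1" "r ^ k - e \<le> q * r ^ k"
    using e(1) r by (auto simp: q_def max_def field_simps)
  have d: "0 < d" "d < 1" "d ^ k = q"
    using q k(1) by (auto simp: d_def)
  \<comment> \<open>The contraction estimate with minorant constant 0 controls the fewer than
    \<open>k\<close> steps that remain after division by \<open>k\<close>.\<close>
  have step1: "w (mat_pow T n *v x) \<le> r ^ n * w x" if "v \<bullet> x = 0" for n x
  proof (induction n)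
    case (Suc n)
    have "w (mat_pow T (Suc n) *v x) = w (T *v (mat_pow T n *v x))"
      by (simp add: matrix_vector_mul_assoc)
    also have "\<dots> \<le> r * w (mat_pow T n *v x)"
      using contr[OF pow0[OF that], of T r 0] vu(4) T0 by simp
    also have "\<dots> \<le> r * (r ^ n * w x)"
      using Suc r by (intro mult_left_mono) auto
    finally show ?case by simp
  qed simp
  \<comment> \<open>The induction strips off \<open>k\<close> steps at a time. The factor
    \<open>1 / q\<close> pays for the remainder, since \<open>q = d ^ k \<le> d ^ n\<close> when
    \<open>n < k\<close>.\<close>
  have decay: "w (mat_pow T n *v x) \<le> (1 / q) * (r * d) ^ n * w x" if "v \<bullet> x = 0" for n x
    using that
  proof (induction n arbitrary: x rule: less_induct)
    case (less n)
    show ?case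
    proof (cases "n < k")
      case True
      have "q \<le> d ^ n"
        unfolding d(3)[symmetric] using d True by (intro power_decreasing) auto
      then have "r ^ n * w x \<le> r ^ n * (d ^ n / q) * w x"
        using r q w0 by (intro mult_right_mono mult_left_mono) (auto simp: field_simps)
      with step1[OF less.prems, of n] show ?thesis
        by (simp add: power_mult_distrib)
    next
      case False
      define y where "y = mat_pow T (n - k) *v x"
      have n: "mat_pow T n *v x = mat_pow T k *v y"
        using False by (simp add: y_def matrix_vector_mul_assoc flip: mat_pow_add)
      have "w (mat_pow T k *v y) \<le> (r ^ k - e) * w y"
        using pow0[OF less.prems] mat_pow_left_eigenvector[of v T r k] vu(4) e(2)
        by (intro contr) (simp_all add: y_def scalar_mult_eq_scaleR)
      also have "\<dots> \<le> (r * d) ^ k * w y"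
        using q(3) w0[of y] by (intro mult_right_mono) (simp_all add: power_mult_distrib d(3) mult.commute)
      also have "\<dots> \<le> (r * d) ^ k * ((1 / q) * (r * d) ^ (n - k) * w x)"
        unfolding y_def using False k(1) r d(1) less.prems
        by (intro mult_left_mono less.IH) auto
      also have "\<dots> = (1 / q) * ((r * d) ^ k * (r * d) ^ (n - k)) * w x"
        by simp
      also have "(r * d) ^ k * (r * d) ^ (n - k) = (r * d) ^ n"
        using False by (simp flip: power_add)
      finally show ?thesis
        unfolding n .
    qed
  qed
  define a where "a = Min (range (\<lambda>i. v $ i))"
  have a: "0 < a" "\<And>i. a \<le> v $ i"
    using vu(2) by (auto simp: a_def)
  have norm_le: "norm x \<le> w x / a" for x
  proof -
    have "norm x \<le> (\<Sum>i\<in>UNIV. \<bar>x $ i\<bar>)"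
      by (rule norm_le_l1_cart)
    also have "\<dots> \<le> (\<Sum>i\<in>UNIV. (v $ i / a) * \<bar>x $ i\<bar>)"
    proof (rule sum_mono)
      show "\<bar>x $ i\<bar> \<le> (v $ i / a) * \<bar>x $ i\<bar>" for i
        using a mult_right_mono[of 1 "v $ i / a" "\<bar>x $ i\<bar>"] by simp
    qed
    finally show ?thesis
      by (simp add: w_def sum_divide_distrib)
  qed
  have w_le: "w x \<le> (\<Sum>i\<in>UNIV. v $ i) * norm x" for x
    unfolding w_def sum_distrib_right
    by (intro sum_mono mult_left_mono component_le_norm_cart less_imp_le[OF vu(2)])
  show ?thesis
  proof (rule that[OF d(1,2)])
    show "0 \<le> (\<Sum>i\<in>UNIV. v $ i) / (a * q)"
      using a q less_imp_le[OF vu(2)] by (intro divide_nonneg_pos sum_nonneg) auto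
  next
    fix n and x :: "real ^ 'm" assume x: "v \<bullet> x = 0"
    have "norm (mat_pow T n *v x) \<le> (1 / q * (r * d) ^ n * w x) / a"
      using norm_le[of "mat_pow T n *v x"] decay[OF x, of n] a(1) by (meson divide_right_mono less_imp_le order_trans)
    also have "\<dots> \<le> (1 / q * (r * d) ^ n * ((\<Sum>i\<in>UNIV. v $ i) * norm x)) / a"
      using q r d a w_le by (intro divide_right_mono mult_left_mono) auto
    also have "\<dots> = (\<Sum>i\<in>UNIV. v $ i) / (a * q) * (pf_eigenvalue T * d) ^ n * norm x"
      by (simp add: r_def mult_ac)
    finally show "norm (mat_pow T n *v x) \<le> (\<Sum>i\<in>UNIV. v $ i) / (a * q) * (pf_eigenvalue T * d) ^ n * norm x" .
  qed
qed

text \<open>The map \<open>f = r - T + u v'\<close> preserves \<open>v' x\<close>, so a vector in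
  its kernel satisfies \<open>v' x = 0\<close> and \<open>T x = r x\<close>; decay on the kernel of
  \<open>v'\<close> then gives \<open>x = 0\<close>. Hence \<open>f\<close> is invertible, and
  \<open>S\<close> is its inverse composed with the projection \<open>I - u v'\<close>.\<close>

lemma reduced_resolvent:
  fixes T :: "real ^ 'm ^ 'm"
  assumes T: "primitive_mat T" and vu: "pf_vectors T v u"
  obtains S :: "real ^ 'm ^ 'm" where "S *v u = 0" "v v* S = 0"
    "\<And>x. pf_eigenvalue T *\<^sub>R (S *v x) - T *v (S *v x) = x - (v \<bullet> x) *\<^sub>R u"
    "\<And>x. S *v (pf_eigenvalue T *\<^sub>R x - T *v x) = x - (v \<bullet> x) *\<^sub>R u"
proof -
  define r where "r = pf_eigenvalue T"
  have r: "0 < r"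
    unfolding r_def by (rule pf_pair_primitive(1)[OF T])
  note vu' = pf_vectorsD[OF vu, folded r_def]
  define f where "f x = r *\<^sub>R x - T *v x + (v \<bullet> x) *\<^sub>R u" for x
  have lin: "linear f"
    by (rule linearI) (simp_all add: f_def algebra_simps inner_add_right)
  have vf: "v \<bullet> f x = v \<bullet> x" for x
    by (simp add: f_def inner_add_right inner_diff_right vu')
  have "x = 0" if "f x = 0" for x
  proof -
    have vx: "v \<bullet> x = 0"
      using vf[of x] that by simp
    then have "T *v x = r *s x"
      using that by (simp add: f_def scalar_mult_eq_scaleR)
    then have pow: "mat_pow T n *v x = r ^ n *\<^sub>R x" for n
      using mat_pow_eigenvector[of T x r n] by (simp add: scalar_mult_eq_scaleR)
    obtain d C where d: "0 < d" "d < 1" "0 \<le> C"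
      and decay: "\<And>n x. v \<bullet> x = 0 \<Longrightarrow> norm (mat_pow T n *v x) \<le> C * (r * d) ^ n * norm x"
      using mat_pow_decay_on_kernel[OF T vu, folded r_def] by blast
    \<comment> \<open>The orbit of \<open>x\<close> grows exactly like \<open>r ^ n\<close>, while
      decay allows only \<open>(r * d) ^ n\<close>.\<close>
    have "norm x \<le> C * d ^ n * norm x" for n
    proof -
      have "norm x * r ^ n \<le> (C * d ^ n * norm x) * r ^ n"
        using decay[OF vx, of n] r by (simp add: pow power_mult_distrib mult_ac)
      then show ?thesis
        using r by (meson mult_right_le_imp_le zero_less_power)
    qed
    moreover have "(\<lambda>n. C * d ^ n * norm x) \<longlonglongrightarrow> C * 0 * norm x"
      using d by (intro tendsto_intros LIMSEQ_realpow_zero) auto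
    ultimately have "norm x \<le> C * 0 * norm x"
      by (intro LIMSEQ_le_const) auto
    then show ?thesis by simp
  qed
  then have "inj f"
    using lin by (simp add: linear_injective_0)
  then obtain g where g: "linear g" "\<And>x. g (f x) = x" "\<And>x. f (g x) = x"
    using linear_injective_isomorphism[OF lin] by metis
  define S where "S = matrix (\<lambda>x. g (x - (v \<bullet> x) *\<^sub>R u))"
  have lin': "linear (\<lambda>x. g (x - (v \<bullet> x) *\<^sub>R u))"
    using linear_compose[OF _ g(1), of "\<lambda>x. x - (v \<bullet> x) *\<^sub>R u"]
    by (simp add: o_def linear_iff algebra_simps inner_add_right)
  have S: "S *v x = g (x - (v \<bullet> x) *\<^sub>R u)" for x
    unfolding S_def by (metis matrix_vector_mul(2)[OF lin'])
  have vg: "v \<bullet> g x = v \<bullet> x" for x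
    using vf[of "g x"] g(3) by simp
  have vS: "v \<bullet> (S *v x) = 0" for x
    by (simp add: S vg inner_diff_right vu')
  show ?thesis
  proof (rule that[of S])
    show "S *v u = 0"
      by (simp add: S vu' linear_0[OF g(1)])
    show "v v* S = 0"
    proof -
      have "(v v* S) \<bullet> (v v* S) = 0"
        by (simp only: dot_lmul_matrix vS)
      then show ?thesis by simp
    qed
    show "pf_eigenvalue T *\<^sub>R (S *v x) - T *v (S *v x) = x - (v \<bullet> x) *\<^sub>R u" for x
      using g(3)[of "x - (v \<bullet> x) *\<^sub>R u"] vS[of x] by (simp add: f_def r_def flip: S)
    show "S *v (pf_eigenvalue T *\<^sub>R x - T *v x) = x - (v \<bullet> x) *\<^sub>R u" for x
    proof -
      have "f u = u"
        by (simp add: f_def vu')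
      then have gu: "g u = u"
        using g(2) by metis
      have "S *v (r *\<^sub>R x - T *v x) = g (f x - (v \<bullet> x) *\<^sub>R u)"
        by (simp add: S inner_diff_right vu') (simp add: f_def)
      then show ?thesis
        by (simp add: linear_diff[OF g(1)] linear_scale[OF g(1)] g(2) gu r_def)
    qed
  qed
qed

section \<open>Perturbation of a positive eigenvector\<close>

lemma bounded_bilinear_matrix_vector_mult:
  "bounded_bilinear ((*v) :: real ^ 'n ^ 'm \<Rightarrow> real ^ 'n \<Rightarrow> real ^ 'm)"
  unfolding bilinear_conv_bounded_bilinear[symmetric] bilinear_def
  by (auto intro!: linearI simp: algebra_simps scaleR_matrix_vector_assoc)

text \<open>A product rule in which the second factor is merely continuous: since
  \<open>G a = 0\<close>, the term \<open>b (G t) (h t - h a)\<close> is of order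
  \<open>norm (t - a)\<close> times a quantity tending to 0. This permits differentiating
  expressions containing \<open>u t\<close> when only its continuity is known.\<close>

lemma has_derivative_bilinear_vanishing:
  assumes b: "bounded_bilinear b" and G: "(G has_derivative G') (at a)" and "G a = 0"
    and h: "isCont h a"
  shows "((\<lambda>t. b (G t) (h t)) has_derivative (\<lambda>x. b (G' x) (h a))) (at a)"
proof -
  interpret bounded_bilinear b by fact
  have G': "bounded_linear G'"
    using G by (rule has_derivative_bounded_linear)
  obtain K where K: "0 < K" "\<And>x. norm (G' x) \<le> norm x * K"
    using bounded_linear.pos_bounded[OF G'] by blast
  obtain L where L: "0 < L" "\<And>x y. norm (b x y) \<le> norm x * norm y * L"
    using pos_bounded by blast
  define R where "R t = norm (G t - G' (t - a)) / norm (t - a)" for t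
  have R: "(R \<longlongrightarrow> 0) (at a)"
    using G \<open>G a = 0\<close> by (simp add: has_derivative_iff_norm R_def[abs_def])
  have "((\<lambda>t. b (G t) (h t - h a)) has_derivative (\<lambda>x. 0)) (at a)"
    unfolding has_derivative_iff_norm
  proof (intro conjI bounded_linear_zero)
    show "((\<lambda>t. norm (b (G t) (h t - h a) - b (G a) (h a - h a) - 0) / norm (t - a)) \<longlongrightarrow> 0) (at a)"
    proof (rule Lim_null_comparison)
      show "\<forall>\<^sub>F t in at a. norm (norm (b (G t) (h t - h a) - b (G a) (h a - h a) - 0) / norm (t - a))
          \<le> (R t + K) * norm (h t - h a) * L"
        unfolding eventually_at_filter
      proof (intro always_eventually allI impI)
        fix t assume t: "t \<noteq> a"
        have "norm (G t) \<le> norm (G t - G' (t - a)) + norm (t - a) * K"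
          using norm_triangle_sub[of "G t" "G' (t - a)"] K(2)[of "t - a"] by simp
        also have "\<dots> = (R t + K) * norm (t - a)"
          using t by (simp add: R_def field_simps)
        finally have "norm (b (G t) (h t - h a)) \<le> (R t + K) * norm (t - a) * norm (h t - h a) * L"
          using L by (meson mult_right_mono less_imp_le norm_ge_zero order_trans)
        then show "norm (norm (b (G t) (h t - h a) - b (G a) (h a - h a) - 0) / norm (t - a))
          \<le> (R t + K) * norm (h t - h a) * L"
          using t by (simp add: zero_right divide_le_eq mult_ac)
      qed
      have "((\<lambda>t. norm (h t - h a)) \<longlongrightarrow> 0) (at a)"
        using h by (intro tendsto_norm_zero) (simp add: isCont_def LIM_zero)
      with R have "((\<lambda>t. (R t + K) * norm (h t - h a) * L) \<longlongrightarrow> (0 + K) * 0 * L) (at a)"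
        by (intro tendsto_intros)
      then show "((\<lambda>t. (R t + K) * norm (h t - h a) * L) \<longlongrightarrow> 0) (at a)"
        by simp
    qed
  qed
  moreover have "((\<lambda>t. b (G t) (h a)) has_derivative (\<lambda>x. b (G' x) (h a))) (at a)"
    by (rule bounded_linear.has_derivative[OF bounded_linear_left G])
  ultimately have "((\<lambda>t. b (G t) (h a) + b (G t) (h t - h a)) has_derivative (\<lambda>x. b (G' x) (h a) + 0)) (at a)"
    by (intro has_derivative_add)
  then show ?thesis
    by (simp flip: add_right)
qed

text \<open>
  With the normalisation \<open>v \<bullet> u t = 1\<close>, multiplying the eigenvalue equation by \<open>v'\<close> gives
  \<open>y t - y a = v' (M t - M a) u t\<close>, and multiplying it by \<open>S\<close> gives
  \<open>u t - u a = S (M t - M a) u t - (y t - y a) S (u t)\<close>. Positivity bounds \<open>u t\<close> a priori, so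
  continuity and then differentiability can be read off from these two identities.
\<close>

lemma positive_eigenvector_has_derivative:
  fixes M :: "'a::real_normed_vector \<Rightarrow> real ^ 'm ^ 'm"
  assumes M: "(M has_derivative M') (at a)"
    and eig: "\<And>t. M t *v u t = y t *\<^sub>R u t"
    and v: "\<And>i. 0 < v $ i" "v v* M a = y a *\<^sub>R v"
    and u: "\<And>t i. 0 \<le> u t $ i" "\<And>t. v \<bullet> u t = 1"
    and S: "\<And>x. S *v (y a *\<^sub>R x - M a *v x) = x - (v \<bullet> x) *\<^sub>R u a" "S *v u a = 0"
  shows "(y has_derivative (\<lambda>h. v \<bullet> (M' h *v u a))) (at a)"
    and "(u has_derivative (\<lambda>h. S *v (M' h *v u a))) (at a)"
proof -
  interpret mv: bounded_bilinear "(*v) :: real ^ 'm ^ 'm \<Rightarrow> real ^ 'm \<Rightarrow> real ^ 'm"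
    by (rule bounded_bilinear_matrix_vector_mult)
  define D where "D t = (M t - M a) *v u t" for t
  have y: "y t = y a + v \<bullet> D t" for t
  proof -
    have "v \<bullet> (M a *v u t) = y a"
      using dot_lmul_matrix[of v "M a" "u t"] v(2) u(2) by simp
    then show ?thesis
      by (simp add: D_def algebra_simps inner_diff_right eig u(2))
  qed
  have u_eq: "u t = u a + S *v D t - (v \<bullet> D t) *\<^sub>R (S *v u t)" for t
  proof -
    have "y a *\<^sub>R u t - M a *v u t = D t - (v \<bullet> D t) *\<^sub>R u t"
    proof -
      have "D t = y t *\<^sub>R u t - M a *v u t" "v \<bullet> D t = y t - y a"
        using y[of t] by (simp_all add: D_def matrix_vector_mult_diff_rdistrib eig)
      then show ?thesis by (simp add: scaleR_left_diff_distrib)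
    qed
    then have "S *v (D t - (v \<bullet> D t) *\<^sub>R u t) = u t - u a"
      using S(1)[of "u t"] u(2) by simp
    then show ?thesis
      by (simp add: matrix_vector_mult_diff_distrib matrix_vector_mult_scaleR algebra_simps)
  qed
  \<comment> \<open>All summands of \<open>v \<bullet> u t = 1\<close> are nonnegative, so each
    coordinate of \<open>u t\<close> is at most \<open>1 / v $ i\<close>, uniformly in
    \<open>t\<close>.\<close>
  define c where "c = (\<Sum>i\<in>UNIV. 1 / v $ i)"
  have u_le: "norm (u t) \<le> c" for t
  proof -
    have "\<bar>u t $ i\<bar> \<le> 1 / v $ i" for i
    proof -
      have "v $ i * u t $ i \<le> v \<bullet> u t"
        unfolding inner_vec_def inner_real_def
        using less_imp_le[OF v(1)] u(1) by (intro member_le_sum) auto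
      then show ?thesis
        using v(1)[of i] u(1)[of t i] by (simp add: u(2) field_simps)
    qed
    then show ?thesis
      unfolding c_def by (intro order_trans[OF norm_le_l1_cart] sum_mono)
  qed
  have M0: "((\<lambda>t. M t - M a) \<longlongrightarrow> 0) (at a)"
    using has_derivative_continuous[OF M] by (simp add: continuous_within LIM_zero)
  obtain K where K: "0 < K" "\<And>x y. norm ((x :: real ^ 'm ^ 'm) *v y) \<le> norm x * norm y * K"
    using mv.pos_bounded by blast
  have D0: "(D \<longlongrightarrow> 0) (at a)"
  proof (rule Lim_null_comparison)
    show "\<forall>\<^sub>F t in at a. norm (D t) \<le> norm (M t - M a) * c * K"
      unfolding D_def using K u_le
      by (intro always_eventually allI order_trans[OF K(2)] mult_right_mono mult_left_mono) auto
    show "((\<lambda>t. norm (M t - M a) * c * K) \<longlongrightarrow> 0) (at a)"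
      by (intro tendsto_mult_left_zero tendsto_norm_zero M0)
  qed
  \<comment> \<open>Both corrections in \<open>u_eq\<close> tend to 0: \<open>D t\<close> does, and
    \<open>S *v u t\<close> stays bounded.\<close>
  have "isCont u a"
  proof -
    have "((\<lambda>t. (v \<bullet> D t) *\<^sub>R (S *v u t)) \<longlongrightarrow> 0) (at a)"
    proof (rule Lim_null_comparison)
      show "\<forall>\<^sub>F t in at a. norm ((v \<bullet> D t) *\<^sub>R (S *v u t)) \<le> \<bar>v \<bullet> D t\<bar> * (norm S * c * K)"
        using K u_le
        by (auto intro!: always_eventually mult_left_mono order_trans[OF K(2)] mult_right_mono)
      have "((\<lambda>t. v \<bullet> D t) \<longlongrightarrow> v \<bullet> 0) (at a)"
        by (intro tendsto_intros D0)
      then show "((\<lambda>t. \<bar>v \<bullet> D t\<bar> * (norm S * c * K)) \<longlongrightarrow> 0) (at a)"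
        by (intro tendsto_mult_left_zero tendsto_rabs_zero) simp
    qed
    moreover have "((\<lambda>t. S *v D t) \<longlongrightarrow> S *v 0) (at a)"
      by (intro bounded_linear.tendsto[OF matrix_vector_mul_bounded_linear] D0)
    ultimately have "((\<lambda>t. u a + S *v D t - (v \<bullet> D t) *\<^sub>R (S *v u t)) \<longlongrightarrow> u a + 0 - 0) (at a)"
      by (intro tendsto_intros) simp_all
    then show ?thesis
      by (simp add: isCont_def flip: u_eq)
  qed
  have D': "(D has_derivative (\<lambda>h. M' h *v u a)) (at a)"
    unfolding D_def
  proof (rule has_derivative_bilinear_vanishing[OF bounded_bilinear_matrix_vector_mult])
    show "((\<lambda>t. M t - M a) has_derivative M') (at a)"
      using has_derivative_diff[OF M has_derivative_const[of "M a"]] by simp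
  qed (use \<open>isCont u a\<close> in simp_all)
  have vD: "((\<lambda>t. v \<bullet> D t) has_derivative (\<lambda>h. v \<bullet> (M' h *v u a))) (at a)"
    by (rule has_derivative_inner_right[OF D'])
  then have "((\<lambda>t. y a + v \<bullet> D t) has_derivative (\<lambda>h. 0 + v \<bullet> (M' h *v u a))) (at a)"
    by (intro has_derivative_add has_derivative_const)
  then show "(y has_derivative (\<lambda>h. v \<bullet> (M' h *v u a))) (at a)"
    by (simp flip: y)
  \<comment> \<open>The scalar factor vanishes at \<open>a\<close>, so continuity of
    \<open>u\<close> suffices here. The resulting derivative contains \<open>S *v u a = 0\<close>
    and drops out.\<close>
  have "((\<lambda>t. (v \<bullet> D t) *\<^sub>R (S *v u t)) has_derivative (\<lambda>h. (v \<bullet> (M' h *v u a)) *\<^sub>R (S *v u a))) (at a)"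
  proof (rule has_derivative_bilinear_vanishing[OF bounded_bilinear_scaleR vD])
    show "isCont (\<lambda>t. S *v u t) a"
      using \<open>isCont u a\<close> unfolding isCont_def
      by (rule bounded_linear.tendsto[OF matrix_vector_mul_bounded_linear])
  qed (simp add: D_def)
  moreover have "((\<lambda>t. S *v D t) has_derivative (\<lambda>h. S *v (M' h *v u a))) (at a)"
    by (rule bounded_linear.has_derivative[OF matrix_vector_mul_bounded_linear D'])
  ultimately have "((\<lambda>t. u a + S *v D t - (v \<bullet> D t) *\<^sub>R (S *v u t)) has_derivative
      (\<lambda>h. 0 + S *v (M' h *v u a) - (v \<bullet> (M' h *v u a)) *\<^sub>R (S *v u a))) (at a)"
    by (intro has_derivative_diff has_derivative_add has_derivative_const)
  then show "(u has_derivative (\<lambda>h. S *v (M' h *v u a))) (at a)"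
    by (simp add: S(2) flip: u_eq)
qed

section \<open>Sums over words\<close>

lemma UNIV_letter: "UNIV = insert LetB (range LetA)"
proof -
  have "x \<in> insert LetB (range LetA)" for x :: "'a letter"
    by (cases x) auto
  then show ?thesis by auto
qed

lemma finite_words: "finite {w :: 'l::finite letter list. length w = n}"
proof -
  have "finite (UNIV :: 'l letter set)"
    by (simp add: UNIV_letter)
  from finite_lists_length_eq[OF this, of n] show ?thesis
    by simp
qed

lemma sum_letters:
  fixes f :: "'l::finite letter \<Rightarrow> 'b::comm_monoid_add"
  shows "(\<Sum>x\<in>UNIV. f x) = (\<Sum>i\<in>UNIV. f (LetA i)) + f LetB"
  unfolding UNIV_letter by (subst sum.insert) (auto simp: sum.reindex inj_on_def add.commute)

lemma sum_words_Suc: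
  fixes f :: "'l::finite letter list \<Rightarrow> 'b::comm_monoid_add"
  shows "(\<Sum>w | length w = Suc n. f w) = (\<Sum>x\<in>UNIV. \<Sum>w | length w = n. f (x # w))"
proof -
  have "{w. length w = Suc n} = (\<lambda>(x, w). x # w) ` (UNIV \<times> {w :: 'l letter list. length w = n})"
    by (auto simp: image_iff length_Suc_conv)
  then show ?thesis
    by (simp add: sum.reindex inj_on_def split_beta sum.cartesian_product)
qed

lemma sum_letter_mat:
  fixes A :: "'l::finite \<Rightarrow> real ^ 'm ^ 'm"
  shows "(\<Sum>x\<in>UNIV. letter_mat A B x *v y) = total_mat A B *v y"
proof -
  interpret mv: bounded_bilinear "(*v) :: real ^ 'm ^ 'm \<Rightarrow> real ^ 'm \<Rightarrow> real ^ 'm"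
    by (rule bounded_bilinear_matrix_vector_mult)
  show ?thesis
    by (simp add: sum_letters total_mat_def mv.add_left mv.sum_left)
qed

lemma sum_word_mat:
  fixes A :: "'l::finite \<Rightarrow> real ^ 'm ^ 'm"
  shows "(\<Sum>w | length w = n. word_mat A B w *v \<eta>) = mat_pow (total_mat A B) n *v \<eta>"
proof (induction n)
  case 0
  then show ?case by simp
next
  case (Suc n)
  interpret mv: bounded_bilinear "(*v) :: real ^ 'm ^ 'm \<Rightarrow> real ^ 'm \<Rightarrow> real ^ 'm"
    by (rule bounded_bilinear_matrix_vector_mult)
  have "(\<Sum>w | length w = Suc n. word_mat A B w *v \<eta>)
      = (\<Sum>x\<in>UNIV. letter_mat A B x *v (\<Sum>w | length w = n. word_mat A B w *v \<eta>))"
    by (simp add: sum_words_Suc mv.sum_right flip: matrix_vector_mul_assoc)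
  then show ?case
    by (simp add: Suc sum_letter_mat flip: matrix_vector_mul_assoc)
qed

text \<open>Counting occurrences amounts to marking one position: the letters before and after it
  are summed freely and give powers of \<open>M\<close>, while the marked letter gives
  \<open>A i\<close>. The induction splits off the first letter.\<close>

lemma sum_count_word_mat:
  fixes A :: "'l::finite \<Rightarrow> real ^ 'm ^ 'm"
  shows "(\<Sum>w | length w = n. real (count_list w (LetA i)) *\<^sub>R (word_mat A B w *v \<eta>))
    = (\<Sum>k<n. mat_pow (total_mat A B) k *v (A i *v (mat_pow (total_mat A B) (n - Suc k) *v \<eta>)))"
proof (induction n)
  case 0
  then show ?case by simp
next
  case (Suc n)
  interpret mv: bounded_bilinear "(*v) :: real ^ 'm ^ 'm \<Rightarrow> real ^ 'm \<Rightarrow> real ^ 'm"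
    by (rule bounded_bilinear_matrix_vector_mult)
  let ?M = "total_mat A B"
  let ?f = "\<lambda>w. word_mat A B w *v \<eta>" and ?c = "\<lambda>w. real (count_list w (LetA i))"
  \<comment> \<open>The first letter either is the marked one, contributing the term without a
    count, or precedes the occurrences counted in the rest of the word.\<close>
  have "(\<Sum>w | length w = Suc n. ?c w *\<^sub>R ?f w)
      = (\<Sum>x\<in>UNIV. \<Sum>w | length w = n. (if x = LetA i then letter_mat A B x *v ?f w else 0)
            + letter_mat A B x *v (?c w *\<^sub>R ?f w))"
    unfolding sum_words_Suc
    by (intro sum.cong refl) (auto simp: algebra_simps simp flip: matrix_vector_mul_assoc)
  also have "\<dots> = (\<Sum>x\<in>UNIV. (if x = LetA i then letter_mat A B x *v (\<Sum>w | length w = n. ?f w) else 0)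
            + letter_mat A B x *v (\<Sum>w | length w = n. ?c w *\<^sub>R ?f w))"
    by (intro sum.cong refl) (simp add: sum.distrib mv.sum_right)
  also have "\<dots> = A i *v (mat_pow ?M n *v \<eta>) + ?M *v (\<Sum>w | length w = n. ?c w *\<^sub>R ?f w)"
    by (simp only: sum.distrib sum_letter_mat sum_word_mat) (simp add: sum_letters)
  \<comment> \<open>The marked first letter is the summand \<open>k = 0\<close>; left multiplication
    by \<open>M\<close> shifts the remaining summands to \<open>k + 1\<close>.\<close>
  also have "\<dots> = (\<Sum>k<Suc n. mat_pow ?M k *v (A i *v (mat_pow ?M (Suc n - Suc k) *v \<eta>)))"
    unfolding Suc by (simp add: sum.lessThan_Suc_shift mv.sum_right matrix_vector_mul_assoc matrix_mul_assoc del: sum.lessThan_Suc)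
  finally show ?case .
qed

lemma nonneg_mat_vec_nonneg:
  assumes "nonneg_mat W" "\<And>i. 0 \<le> x $ i"
  shows "0 \<le> (W *v x) $ i"
  using assms by (auto simp: nonneg_mat_def matrix_vector_mult_def intro!: sum_nonneg)

lemma linear_representation_weight_nonneg:
  assumes "linear_representation \<xi> A B \<eta>"
  shows "0 \<le> \<xi> \<bullet> (word_mat A B w *v \<eta>)"
proof -
  have "0 \<le> (word_mat A B w *v \<eta>) $ i" for i
  proof (induction w arbitrary: i)
    case Nil
    then show ?case
      using assms by (simp add: linear_representation_def)
  next
    case (Cons x w)
    have "nonneg_mat (letter_mat A B x)"
      using assms by (cases x) (simp_all add: linear_representation_def)
    from nonneg_mat_vec_nonneg[OF this Cons] show ?case
      by (simp flip: matrix_vector_mul_assoc)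
  qed
  then show ?thesis
    using assms by (auto simp: linear_representation_def inner_vec_def intro!: sum_nonneg)
qed

text \<open>The integral over a finite point measure is a weighted sum over words. If the
  denominator is 0, both sides are 0 by the convention for division.\<close>

lemma mean_counts_eq:
  assumes "linear_representation \<xi> A B \<eta>"
  shows "mean_counts \<xi> A B \<eta> n $ i =
    (\<Sum>k<n. \<xi> \<bullet> (mat_pow (total_mat A B) k *v (A i *v (mat_pow (total_mat A B) (n - Suc k) *v \<eta>))))
      / (\<xi> \<bullet> (mat_pow (total_mat A B) n *v \<eta>))"
proof -
  let ?D = "\<xi> \<bullet> (mat_pow (total_mat A B) n *v \<eta>)"
  have "0 \<le> ?D"
    unfolding sum_word_mat[symmetric] inner_sum_right
    by (intro sum_nonneg linear_representation_weight_nonneg[OF assms])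
  then have "mean_counts \<xi> A B \<eta> n $ i =
      (\<Sum>w | length w = n. (\<xi> \<bullet> (word_mat A B w *v \<eta>)) / ?D * real (count_list w (LetA i)))"
    unfolding mean_counts_def word_measure_def
    by (simp add: symbol_counts_def lebesgue_integral_point_measure_finite[OF finite_words]
        linear_representation_weight_nonneg[OF assms])
  also have "\<dots> = \<xi> \<bullet> (\<Sum>w | length w = n. real (count_list w (LetA i)) *\<^sub>R (word_mat A B w *v \<eta>)) / ?D"
    by (simp add: inner_sum_right sum_divide_distrib mult_ac)
  finally show ?thesis
    by (simp add: sum_count_word_mat inner_sum_right)
qed

section \<open>Asymptotic expansions\<close>

text \<open>The remainder \<open>q k\<close> is the \<open>k\<close>-th power of \<open>T\<close>,
  divided by \<open>r ^ k\<close>, applied to the part of \<open>\<eta>\<close> in the kernel of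
  \<open>v'\<close>. That part equals \<open>(r - T) S \<eta>\<close>, so the sum of the remainders
  telescopes to \<open>r S \<eta>\<close> up to a geometrically small term.\<close>

lemma mat_pow_spectral_expansion:
  fixes T S :: "real ^ 'm ^ 'm"
  assumes T: "primitive_mat T" and vu: "pf_vectors T v u"
    and vS: "v v* S = 0"
    and S: "\<And>x. pf_eigenvalue T *\<^sub>R (S *v x) - T *v (S *v x) = x - (v \<bullet> x) *\<^sub>R u"
  obtains d C q where "0 < d" "d < 1" "0 \<le> C"
    "\<And>k. mat_pow T k *v \<eta> = pf_eigenvalue T ^ k *\<^sub>R ((v \<bullet> \<eta>) *\<^sub>R u + q k)"
    "\<And>k. norm (q k) \<le> C * d ^ k"
    "\<And>n. norm ((\<Sum>k<n. q k) - pf_eigenvalue T *\<^sub>R (S *v \<eta>)) \<le> C * d ^ n"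
proof -
  define r where "r = pf_eigenvalue T"
  have r: "0 < r"
    unfolding r_def by (rule pf_pair_primitive(1)[OF T])
  note vu' = pf_vectorsD[OF vu, folded r_def]
  obtain d C where d: "0 < d" "d < 1" "0 \<le> C"
    and decay: "\<And>n x. v \<bullet> x = 0 \<Longrightarrow> norm (mat_pow T n *v x) \<le> C * (r * d) ^ n * norm x"
    using mat_pow_decay_on_kernel[OF T vu, folded r_def] by blast
  define N where "N k x = (1 / r ^ k) *\<^sub>R (mat_pow T k *v x)" for k x
  have N: "norm (N k x) \<le> C * d ^ k * norm x" if "v \<bullet> x = 0" for k x
    using decay[OF that, of k] r by (simp add: N_def divide_le_eq power_mult_distrib mult_ac)
  define \<eta>0 where "\<eta>0 = \<eta> - (v \<bullet> \<eta>) *\<^sub>R u"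
  have \<eta>0: "v \<bullet> \<eta>0 = 0"
    by (simp add: \<eta>0_def inner_diff_right vu')
  have S\<eta>: "v \<bullet> (S *v \<eta>) = 0"
    using dot_lmul_matrix[of v S \<eta>] vS by simp
  have Nu: "N k u = u" for k
    using mat_pow_eigenvector[of T u r k] vu'(3) r by (simp add: N_def scalar_mult_eq_scaleR)
  have Ndiff: "N k \<eta>0 = r *\<^sub>R N k (S *v \<eta>) - r *\<^sub>R N (Suc k) (S *v \<eta>)" for k
  proof -
    have "\<eta>0 = r *\<^sub>R (S *v \<eta>) - T *v (S *v \<eta>)"
      using S[of \<eta>] by (simp add: \<eta>0_def r_def)
    then have "mat_pow T k *v \<eta>0 = r *\<^sub>R (mat_pow T k *v (S *v \<eta>)) - mat_pow T (Suc k) *v (S *v \<eta>)"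
      by (simp add: matrix_vector_mult_diff_distrib matrix_vector_mult_scaleR)
        (simp add: matrix_vector_mul_assoc matrix_mul_assoc flip: mat_pow_commute)
    then show ?thesis
      using r by (simp add: N_def scaleR_right_diff_distrib)
  qed
  \<comment> \<open>One constant serves both the bound on \<open>q k\<close> and the bound on the
    tail of its partial sums.\<close>
  define C' where "C' = C * (norm \<eta>0 + r * norm (S *v \<eta>))"
  have C': "0 \<le> C'"
    using d r by (simp add: C'_def)
  show ?thesis
  proof (rule that[OF d(1,2) C', of "\<lambda>k. N k \<eta>0"])
    fix k
    have "N k \<eta> = (v \<bullet> \<eta>) *\<^sub>R N k u + N k \<eta>0"
      by (simp add: N_def \<eta>0_def algebra_simps)
    then have "r ^ k *\<^sub>R N k \<eta> = r ^ k *\<^sub>R ((v \<bullet> \<eta>) *\<^sub>R u + N k \<eta>0)"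
      by (simp only: Nu)
    then show "mat_pow T k *v \<eta> = pf_eigenvalue T ^ k *\<^sub>R ((v \<bullet> \<eta>) *\<^sub>R u + N k \<eta>0)"
      using r by (simp add: N_def[of k \<eta>] flip: r_def)
  next
    fix k
    have "C * d ^ k * norm \<eta>0 \<le> C' * d ^ k"
      using d r by (simp add: C'_def algebra_simps)
    with N[OF \<eta>0, of k] show "norm (N k \<eta>0) \<le> C' * d ^ k"
      by simp
  next
    fix n
    have "(\<Sum>k<n. N k \<eta>0) = r *\<^sub>R N 0 (S *v \<eta>) - r *\<^sub>R N n (S *v \<eta>)"
      unfolding Ndiff by (rule sum_lessThan_telescope')
    then have "norm ((\<Sum>k<n. N k \<eta>0) - r *\<^sub>R (S *v \<eta>)) = r * norm (N n (S *v \<eta>))"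
      using r by (simp add: N_def[of 0])
    also have "\<dots> \<le> r * (C * d ^ n * norm (S *v \<eta>))"
      using r by (intro mult_left_mono N S\<eta>) auto
    also have "\<dots> \<le> C' * d ^ n"
      using d r by (simp add: C'_def algebra_simps)
    finally show "norm ((\<Sum>k<n. N k \<eta>0) - pf_eigenvalue T *\<^sub>R (S *v \<eta>)) \<le> C' * d ^ n"
      by (simp add: r_def)
  qed
qed

text \<open>Expanding the product gives \<open>n\<close> copies of \<open>h x y\<close>, two mixed
  sums converging geometrically to \<open>h x Q\<close> and \<open>h P y\<close>, and
  \<open>n\<close> products of two remainders, each of order \<open>d ^ n\<close>.\<close>

lemma bilinear_convolution_asymptotics:
  fixes h :: "'a::real_normed_vector \<Rightarrow> 'b::real_normed_vector \<Rightarrow> real"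
  assumes h: "bounded_bilinear h" and d: "0 < d" and C: "0 \<le> C"
    and p: "\<And>k. norm (p k) \<le> C * d ^ k" "\<And>n. norm ((\<Sum>k<n. p k) - P) \<le> C * d ^ n"
    and q: "\<And>k. norm (q k) \<le> C * d ^ k" "\<And>n. norm ((\<Sum>k<n. q k) - Q) \<le> C * d ^ n"
  shows "(\<lambda>n. (\<Sum>k<n. h (x + p k) (y + q (n - Suc k))) - (real n * h x y + h x Q + h P y))
           \<in> O(\<lambda>n. real (Suc n) * d ^ n)"
proof -
  interpret bounded_bilinear h by fact
  obtain L where L: "0 < L" "\<And>x y. norm (h x y) \<le> norm x * norm y * L"
    using pos_bounded by blast
  \<comment> \<open>The three summands bound the two mixed errors and the products of remainders;
    the division by \<open>d\<close> arises because the exponents \<open>k\<close> and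
    \<open>n - Suc k\<close> add up to only \<open>n - 1\<close>.\<close>
  define K where "K = norm x * C * L + C * norm y * L + C * C * L / d"
  have "norm ((\<Sum>k<n. h (x + p k) (y + q (n - Suc k))) - (real n * h x y + h x Q + h P y))
          \<le> K * norm (real (Suc n) * d ^ n)" for n
  proof -
    have rev: "(\<Sum>k<n. q (n - Suc k)) = (\<Sum>k<n. q k)"
      by (rule sum.nat_diff_reindex)
    have "(\<Sum>k<n. h (x + p k) (y + q (n - Suc k))) - (real n * h x y + h x Q + h P y)
        = h x ((\<Sum>k<n. q k) - Q) + h ((\<Sum>k<n. p k) - P) y + (\<Sum>k<n. h (p k) (q (n - Suc k)))"
      by (simp add: add_left add_right diff_left diff_right sum.distrib flip: sum_left sum_right rev)
    also have "norm \<dots> \<le> norm x * (C * d ^ n) * L + (C * d ^ n) * norm y * L + real n * (C * C * L / d * d ^ n)"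
    proof (intro norm_triangle_mono)
      show "norm (h x ((\<Sum>k<n. q k) - Q)) \<le> norm x * (C * d ^ n) * L"
        using L(1) by (intro order_trans[OF L(2)] mult_right_mono mult_left_mono q) auto
      show "norm (h ((\<Sum>k<n. p k) - P) y) \<le> (C * d ^ n) * norm y * L"
        using L(1) by (intro order_trans[OF L(2)] mult_right_mono mult_left_mono p) auto
      have "norm (h (p k) (q (n - Suc k))) \<le> C * C * L / d * d ^ n" if "k < n" for k
      proof -
        have "norm (h (p k) (q (n - Suc k))) \<le> (C * d ^ k) * (C * d ^ (n - Suc k)) * L"
          using L(1) C d by (intro order_trans[OF L(2)] mult_right_mono mult_mono p q) auto
        also have "\<dots> = C * C * L / d * (d ^ Suc k * d ^ (n - Suc k))"
          using d by simp
        also have "d ^ Suc k * d ^ (n - Suc k) = d ^ n"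
          unfolding power_add[symmetric] using that by simp
        finally show ?thesis .
      qed
      then show "norm (\<Sum>k<n. h (p k) (q (n - Suc k))) \<le> real n * (C * C * L / d * d ^ n)"
        using sum_norm_bound[of "{..<n}" "\<lambda>k. h (p k) (q (n - Suc k))" "C * C * L / d * d ^ n"] by simp
    qed
    also have "\<dots> \<le> real (Suc n) * (norm x * (C * d ^ n) * L) + real (Suc n) * ((C * d ^ n) * norm y * L)
        + real (Suc n) * (C * C * L / d * d ^ n)"
    proof -
      have "z \<le> real (Suc n) * z" if "0 \<le> z" for z
        using that by (simp add: algebra_simps)
      then show ?thesis
        using C L(1) d by (intro add_mono mult_right_mono) auto
    qed
    also have "\<dots> = K * norm (real (Suc n) * d ^ n)"
      using d by (simp add: K_def algebra_simps add_divide_distrib)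
    finally show ?thesis .
  qed
  then show ?thesis
    by (intro bigoI[of _ K] always_eventually allI)
qed

text \<open>Any larger base absorbs the linear factor, because \<open>n (d / e) ^ n\<close> tends to
  0.\<close>

lemma linear_times_power_bigo:
  fixes d e :: real
  assumes "0 < d" "d < e"
  shows "(\<lambda>n. real (Suc n) * d ^ n) \<in> O(\<lambda>n. e ^ n)"
proof (rule bigoI_tendsto)
  have "(\<lambda>n. real n * (d / e) ^ n + (d / e) ^ n) \<longlonglongrightarrow> 0 + 0"
    using assms by (intro tendsto_add powser_times_n_limit_0 LIMSEQ_realpow_zero) auto
  moreover have "(\<lambda>n. real n * (d / e) ^ n + (d / e) ^ n) = (\<lambda>n. real (Suc n) * d ^ n / e ^ n)"
    by (simp add: fun_eq_iff power_divide algebra_simps add_divide_distrib)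
  ultimately show "(\<lambda>n. real (Suc n) * d ^ n / e ^ n) \<longlonglongrightarrow> 0"
    by simp
qed (use assms in auto)

text \<open>With \<open>X n = n b / a + c / a\<close>, the error is
  \<open>((f n - X n * a) - X n * (g n - a)) / g n\<close>. Here \<open>X\<close> grows linearly and
  \<open>g\<close> tends to \<open>a\<close>, which is nonzero.\<close>

lemma ratio_affine_asymptotics:
  fixes f g :: "nat \<Rightarrow> real"
  assumes f: "(\<lambda>n. f n - (real n * b + c)) \<in> O(\<lambda>n. real (Suc n) * d ^ n)"
    and g: "(\<lambda>n. g n - a) \<in> O(\<lambda>n. d ^ n)" and a: "a \<noteq> 0" and d: "0 < d" "d < e" "d < 1"
  shows "(\<lambda>n. f n / g n - (real n * (b / a) + c / a)) \<in> O(\<lambda>n. e ^ n)"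
proof -
  have "(\<lambda>n. d ^ n) \<in> o(\<lambda>n. 1 :: real)"
    using d by (intro smalloI_tendsto) (simp_all add: LIMSEQ_realpow_zero)
  then have "(\<lambda>n. g n - a) \<in> o(\<lambda>n. 1)"
    by (rule landau_o.big_small_trans[OF g])
  from smalloD_tendsto[OF this] have lim: "g \<longlonglongrightarrow> a"
    by (simp add: LIM_zero_iff)
  have ev: "\<forall>\<^sub>F n in sequentially. g n \<noteq> 0"
    using tendsto_imp_eventually_ne[OF lim a] .
  have "(\<lambda>n. inverse (g n)) \<longlonglongrightarrow> inverse a"
    by (rule tendsto_inverse[OF lim a])
  then have inv: "(\<lambda>n. inverse (g n)) \<in> O(\<lambda>n. 1)"
    by (intro bigoI_tendsto[where c = "inverse a"]) auto
  define X where "X n = real n * (b / a) + c / a" for n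
  have Xa: "X n * a = real n * b + c" for n
    using a by (simp add: X_def distrib_right)
  have "X \<in> O(\<lambda>n. real (Suc n))"
  proof (rule bigoI[of _ "\<bar>b / a\<bar> + \<bar>c / a\<bar>"], intro always_eventually allI)
    fix n
    have "\<bar>X n\<bar> \<le> \<bar>b / a\<bar> * real n + \<bar>c / a\<bar> * 1"
      unfolding X_def by (rule order_trans[OF abs_triangle_ineq]) (simp add: abs_mult mult.commute)
    also have "\<dots> \<le> \<bar>b / a\<bar> * real (Suc n) + \<bar>c / a\<bar> * real (Suc n)"
      by (intro add_mono mult_left_mono) auto
    finally show "norm (X n) \<le> (\<bar>b / a\<bar> + \<bar>c / a\<bar>) * norm (real (Suc n))"
      by (simp only: distrib_right real_norm_def abs_of_nat)
  qed
  from landau_o.big.mult[OF this g]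
  have "(\<lambda>n. (f n - X n * a) - X n * (g n - a)) \<in> O(\<lambda>n. real (Suc n) * d ^ n)"
    by (intro sum_in_bigo f[folded Xa])
  from landau_o.big.mult[OF this inv]
  have "(\<lambda>n. ((f n - X n * a) - X n * (g n - a)) * inverse (g n)) \<in> O(\<lambda>n. real (Suc n) * d ^ n)"
    by simp
  moreover have "\<forall>\<^sub>F n in sequentially. ((f n - X n * a) - X n * (g n - a)) * inverse (g n) = f n / g n - X n"
    using ev by (rule eventually_mono) (simp add: field_simps)
  ultimately have "(\<lambda>n. f n / g n - X n) \<in> O(\<lambda>n. real (Suc n) * d ^ n)"
    by (simp only: landau_o.big.in_cong)
  then show ?thesis
    unfolding X_def using linear_times_power_bigo[OF d(1,2)] by (rule landau_o.big.trans)
qed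


section \<open>Derivatives of the spectral data and the main theorem\<close>

lemma bounded_linear_transpose: "bounded_linear (transpose :: real ^ 'n ^ 'm \<Rightarrow> real ^ 'm ^ 'n)"
  unfolding linear_conv_bounded_linear[symmetric]
  by (intro linearI) (simp_all add: transpose_def vec_eq_iff)

text \<open>The chosen eigenvectors may be rescaled arbitrarily from one \<open>t\<close> to the
  next, so they need not be continuous. Only their scale-invariant product is differentiated, after
  renormalising both vectors against the fixed pair at \<open>a\<close>.\<close>

lemma pf_projection_has_derivative:
  fixes M :: "'a::real_normed_vector \<Rightarrow> real ^ 'm ^ 'm"
  assumes M: "(M has_derivative M') (at a)" and prim: "\<And>t. primitive_mat (M t)"
    and u_def: "u = pf_right (M a)" and v_def: "v = pf_left (M a)"
    and Su: "S *v u = 0" and vS: "v v* S = 0"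
    and S1: "\<And>x. pf_eigenvalue (M a) *\<^sub>R (S *v x) - M a *v (S *v x) = x - (v \<bullet> x) *\<^sub>R u"
    and S2: "\<And>x. S *v (pf_eigenvalue (M a) *\<^sub>R x - M a *v x) = x - (v \<bullet> x) *\<^sub>R u"
  shows "((\<lambda>t. pf_eigenvalue (M t)) has_derivative (\<lambda>h. v \<bullet> (M' h *v u))) (at a)"
    and "((\<lambda>t. (\<xi> \<bullet> pf_right (M t)) * (pf_left (M t) \<bullet> \<eta>)) has_derivative
      (\<lambda>h. (\<xi> \<bullet> (S *v (M' h *v u))) * (v \<bullet> \<eta>) + (\<xi> \<bullet> u) * (v \<bullet> (M' h *v (S *v \<eta>))))) (at a)"
proof -
  define y where "y t = pf_eigenvalue (M t)" for t
  define U where "U t = pf_right (M t)" for t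
  define V where "V t = pf_left (M t)" for t
  note vu = pf_vectorsD[OF pf_pair_primitive(2)[OF prim], folded y_def U_def V_def]
  have ua: "u = U a" and va: "v = V a"
    by (simp_all add: u_def v_def U_def V_def)
  have pos: "0 < v \<bullet> U t" "0 < u \<bullet> V t" for t
    unfolding ua va by (intro inner_pos_vec vu)+
  define U1 where "U1 t = (1 / (v \<bullet> U t)) *\<^sub>R U t" for t
  define V1 where "V1 t = (1 / (u \<bullet> V t)) *\<^sub>R V t" for t
  have vu1: "v \<bullet> u = 1"
    by (simp add: ua va vu)
  have U1a: "U1 a = u" and V1a: "V1 a = v"
    using vu1 by (simp_all add: U1_def V1_def inner_commute[of u v] flip: ua va)
  have eig: "M t *v U1 t = y t *\<^sub>R U1 t" for t
    by (simp add: U1_def matrix_vector_mult_scaleR vu)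
  have v_props: "0 < v $ i" "v v* M a = y a *\<^sub>R v" for i
    by (simp_all add: va vu)
  have U1_props: "0 \<le> U1 t $ i" "v \<bullet> U1 t = 1" for t i
    using pos[of t] by (simp_all add: U1_def less_imp_le[OF vu(1)])
  have S_props: "S *v (y a *\<^sub>R x - M a *v x) = x - (v \<bullet> x) *\<^sub>R U1 a" "S *v U1 a = 0" for x
    using S2[of x] by (simp_all add: U1a y_def Su)
  note right = positive_eigenvector_has_derivative[OF M eig v_props U1_props S_props]
  have "(V1 has_derivative (\<lambda>h. transpose S *v (transpose (M' h) *v V1 a))) (at a)"
  proof (rule positive_eigenvector_has_derivative(2)[where v = u and y = y])
    show "((\<lambda>t. transpose (M t)) has_derivative (\<lambda>h. transpose (M' h))) (at a)"
      by (rule bounded_linear.has_derivative[OF bounded_linear_transpose M])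
    show "transpose (M t) *v V1 t = y t *\<^sub>R V1 t" for t
      by (simp add: V1_def scaleR_vector_matrix_assoc vu)
    show "0 < u $ i" "u v* transpose (M a) = y a *\<^sub>R u" for i
      by (simp_all add: ua vu)
    show "0 \<le> V1 t $ i" "u \<bullet> V1 t = 1" for t i
      using pos[of t] by (simp_all add: V1_def less_imp_le[OF vu(2)])
    show "transpose S *v V1 a = 0"
      by (simp add: V1a vS)
    \<comment> \<open>The transposed resolvent identity follows from \<open>S1\<close> by pairing
      with an arbitrary \<open>z\<close>.\<close>
    show "transpose S *v (y a *\<^sub>R x - transpose (M a) *v x) = x - (u \<bullet> x) *\<^sub>R V1 a" for x
    proof -
      have "((y a *\<^sub>R x - x v* M a) v* S) \<bullet> z = (x - (u \<bullet> x) *\<^sub>R v) \<bullet> z" for z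
      proof -
        have "((y a *\<^sub>R x - x v* M a) v* S) \<bullet> z = x \<bullet> (y a *\<^sub>R (S *v z) - M a *v (S *v z))"
          by (simp add: dot_lmul_matrix inner_diff_left inner_diff_right)
        also have "\<dots> = (x - (u \<bullet> x) *\<^sub>R v) \<bullet> z"
          unfolding y_def S1 by (simp add: inner_diff_left inner_diff_right inner_commute)
        finally show ?thesis .
      qed
      then have "(y a *\<^sub>R x - x v* M a) v* S = x - (u \<bullet> x) *\<^sub>R v"
        using vector_eq_rdot by blast
      then show ?thesis
        by (simp add: V1a)
    qed
  qed
  then have left: "(V1 has_derivative (\<lambda>h. (v v* M' h) v* S)) (at a)"
    by (simp add: V1a)
  show "((\<lambda>t. pf_eigenvalue (M t)) has_derivative (\<lambda>h. v \<bullet> (M' h *v u))) (at a)"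
    using right(1) by (simp add: U1a y_def[abs_def])
  \<comment> \<open>Since \<open>V t \<bullet> U t = 1\<close>, dividing by
    \<open>V1 t \<bullet> U1 t\<close> cancels the two rescalings.\<close>
  have "(\<xi> \<bullet> U t) * (V t \<bullet> \<eta>) = (\<xi> \<bullet> U1 t) * (V1 t \<bullet> \<eta>) / (V1 t \<bullet> U1 t)" for t
    using pos[of t] by (simp add: U1_def V1_def vu)
  moreover have "((\<lambda>t. (\<xi> \<bullet> U1 t) * (V1 t \<bullet> \<eta>) / (V1 t \<bullet> U1 t)) has_derivative
      (\<lambda>h. (\<xi> \<bullet> (S *v (M' h *v u))) * (v \<bullet> \<eta>) + (\<xi> \<bullet> u) * (v \<bullet> (M' h *v (S *v \<eta>))))) (at a)"
  proof -
    have *: "((v v* M' h) v* S) \<bullet> z = v \<bullet> (M' h *v (S *v z))" for h z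
      by (simp only: dot_lmul_matrix)
    have **: "v \<bullet> (S *v z) = 0" for z
      using dot_lmul_matrix[of v S z] vS by simp
    have num: "((\<lambda>t. (\<xi> \<bullet> U1 t) * (V1 t \<bullet> \<eta>)) has_derivative
      (\<lambda>h. (\<xi> \<bullet> U1 a) * (((v v* M' h) v* S) \<bullet> \<eta>) + (\<xi> \<bullet> (S *v (M' h *v U1 a))) * (V1 a \<bullet> \<eta>))) (at a)"
      by (intro has_derivative_mult has_derivative_inner_right has_derivative_inner_left right left)
    \<comment> \<open>This derivative is 0, by \<open>v' S = 0\<close> and \<open>S u = 0\<close>,
      and the value at \<open>a\<close> is 1, so the denominator does not affect the derivative of
      the quotient.\<close>
    have den: "((\<lambda>t. V1 t \<bullet> U1 t) has_derivative
      (\<lambda>h. V1 a \<bullet> (S *v (M' h *v U1 a)) + ((v v* M' h) v* S) \<bullet> U1 a)) (at a)"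
      by (intro has_derivative_inner right left)
    show ?thesis
      using has_derivative_divide'[OF num den] vu1
      by (simp add: U1a V1a * ** Su add.commute)
  qed
  ultimately show "((\<lambda>t. (\<xi> \<bullet> pf_right (M t)) * (pf_left (M t) \<bullet> \<eta>)) has_derivative
      (\<lambda>h. (\<xi> \<bullet> (S *v (M' h *v u))) * (v \<bullet> \<eta>) + (\<xi> \<bullet> u) * (v \<bullet> (M' h *v (S *v \<eta>))))) (at a)"
    by (simp add: U_def V_def)
qed

lemma gradient_eqI:
  assumes "(f has_derivative (\<lambda>h. h \<bullet> D)) (at x)"
  shows "gradient f x = D"
  unfolding gradient_def gderiv_def
proof (rule the_equality)
  fix D' assume "(f has_derivative (\<lambda>h. h \<bullet> D')) (at x)"
  then have "(\<lambda>h. h \<bullet> D') = (\<lambda>h. h \<bullet> D)"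
    using assms by (rule has_derivative_unique)
  then show "D' = D"
    by (metis vector_eq_ldot)
qed (rule assms)

lemma tilted_mat_has_derivative:
  "(tilted_mat A B has_derivative (\<lambda>h. \<Sum>i\<in>UNIV. h $ i *\<^sub>R A i)) (at 0)"
proof -
  have "((\<lambda>t. exp (t $ i) *\<^sub>R A i) has_derivative (\<lambda>h. h $ i *\<^sub>R A i)) (at 0)" for i
  proof -
    have "((\<lambda>t :: real ^ 'a. t $ i) has_derivative (\<lambda>h. h $ i)) (at 0)"
      by (rule bounded_linear_imp_has_derivative[OF bounded_linear_vec_nth])
    from has_derivative_exp[OF this] show ?thesis
      by (intro has_derivative_scaleR_left) simp
  qed
  then have "((\<lambda>t. (\<Sum>i\<in>UNIV. exp (t $ i) *\<^sub>R A i) + B) has_derivative (\<lambda>h. (\<Sum>i\<in>UNIV. h $ i *\<^sub>R A i) + 0)) (at 0)"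
    by (intro has_derivative_add has_derivative_sum has_derivative_const)
  then show ?thesis
    by (simp add: tilted_mat_def[abs_def])
qed

lemma tilted_mat_0: "tilted_mat A B 0 = total_mat A B"
  by (simp add: tilted_mat_def total_mat_def)

text \<open>With \<open>c\<close> the least of 1 and all the factors \<open>exp (t $ i)\<close>, the
  tilted matrix dominates \<open>c\<close> times the total matrix entrywise; the 1 accounts for the
  untilted \<open>B\<close>.\<close>

lemma primitive_tilted_mat:
  assumes A: "\<And>i. nonneg_mat (A i)" and B: "nonneg_mat B" and prim: "primitive_mat (total_mat A B)"
  shows "primitive_mat (tilted_mat A B t)"
proof -
  define c where "c = Min (insert 1 (range (\<lambda>i. exp (t $ i))))"
  have c: "0 < c" "c \<le> 1"
    by (auto simp: c_def)
  have c_le: "c \<le> exp (t $ i)" for i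
    unfolding c_def by (intro Min_le) auto
  show ?thesis
  proof (rule primitive_mat_dominated[OF prim c(1)])
    fix i j
    have "c * total_mat A B $ i $ j = (\<Sum>l\<in>UNIV. c * A l $ i $ j) + c * B $ i $ j"
      by (simp add: total_mat_def distrib_left sum_distrib_left)
    also have "\<dots> \<le> (\<Sum>l\<in>UNIV. exp (t $ l) * A l $ i $ j) + 1 * B $ i $ j"
      using A B c c_le by (intro add_mono sum_mono mult_right_mono) (auto simp: nonneg_mat_def)
    finally show "c * total_mat A B $ i $ j \<le> tilted_mat A B t $ i $ j"
      by (simp add: tilted_mat_def)
  qed
qed

lemma inner_nonneg_pos:
  fixes x u :: "real ^ 'm"
  assumes "\<And>i. 0 \<le> x $ i" "x \<noteq> 0" "\<And>i. 0 < u $ i"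
  shows "0 < x \<bullet> u"
proof -
  obtain i where "x $ i \<noteq> 0"
    using assms(2) by (auto simp: vec_eq_iff)
  then show ?thesis
    unfolding inner_vec_def inner_real_def using assms
    by (intro sum_pos2[of _ i]) (auto simp: less_le intro!: mult_nonneg_nonneg)
qed

theorem mainTheorem5:
  fixes \<xi> \<eta> :: "real ^ 'm" and A :: "'l::finite \<Rightarrow> real ^ 'm ^ 'm" and B :: "real ^ 'm ^ 'm"
  assumes rep: "linear_representation \<xi> A B \<eta>"
    and A_nonzero: "\<And>i. A i \<noteq> 0" and B_nonzero: "B \<noteq> 0"
    and support: "\<forall>\<^sub>F n in sequentially. \<exists>w. length w = n \<and> \<xi> \<bullet> (word_mat A B w *v \<eta>) > 0"
    and prim: "primitive_mat (total_mat A B)"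
  shows "let lam = pf_eigenvalue (total_mat A B);
             \<beta> = gradient (y_fun A B) 0 /\<^sub>R lam;
             c = gradient (r_fun \<xi> A B \<eta>) 0
         in \<exists>\<epsilon>\<in>{0<..<1}.
              (\<lambda>n. norm (mean_counts \<xi> A B \<eta> n - (real n *\<^sub>R \<beta> + c))) \<in> O(\<lambda>n. \<epsilon> ^ n)"
proof -
  define M where "M = total_mat A B"
  define r where "r = pf_eigenvalue M"
  define u where "u = pf_right M"
  define v where "v = pf_left M"
  note prim = prim[folded M_def]
  have r: "0 < r"
    unfolding r_def by (rule pf_pair_primitive(1)[OF prim])
  have vu: "pf_vectors M v u"
    unfolding u_def v_def by (rule pf_pair_primitive(2)[OF prim])
  note vu' = pf_vectorsD[OF vu, folded r_def]
  obtain S where S: "S *v u = 0" "v v* S = 0"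
    "\<And>x. r *\<^sub>R (S *v x) - M *v (S *v x) = x - (v \<bullet> x) *\<^sub>R u"
    "\<And>x. S *v (r *\<^sub>R x - M *v x) = x - (v \<bullet> x) *\<^sub>R u"
    using reduced_resolvent[OF prim vu, folded r_def] by blast
  have primt: "primitive_mat (tilted_mat A B t)" for t
    using rep prim by (intro primitive_tilted_mat) (auto simp: linear_representation_def M_def)
  interpret mv: bounded_bilinear "(*v) :: real ^ 'm ^ 'm \<Rightarrow> real ^ 'm \<Rightarrow> real ^ 'm"
    by (rule bounded_bilinear_matrix_vector_mult)

  \<comment> \<open>Gradients of \<open>y\<close> and \<open>r\<close> at the origin\<close>
  have grad_y: "gradient (y_fun A B) 0 = (\<chi> i. v \<bullet> (A i *v u))"
  proof (rule gradient_eqI)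
    have "(y_fun A B has_derivative (\<lambda>h. v \<bullet> ((\<Sum>i\<in>UNIV. h $ i *\<^sub>R A i) *v u))) (at 0)"
      unfolding y_fun_def[abs_def]
      by (rule pf_projection_has_derivative(1)[OF tilted_mat_has_derivative primt, where S = S])
        (simp_all add: tilted_mat_0 u_def v_def S[unfolded u_def v_def r_def] flip: M_def)
    also have "(\<lambda>h. v \<bullet> ((\<Sum>i\<in>UNIV. h $ i *\<^sub>R A i) *v u)) = (\<lambda>h. h \<bullet> (\<chi> i. v \<bullet> (A i *v u)))"
      by (simp add: fun_eq_iff mv.sum_left mv.scaleR_left inner_sum_right inner_vec_def[where 'a = real and 'b = 'l])
    finally show "(y_fun A B has_derivative (\<lambda>h. h \<bullet> (\<chi> i. v \<bullet> (A i *v u)))) (at 0)" .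
  qed

  define g where "g = (\<xi> \<bullet> u) * (v \<bullet> \<eta>)"
  \<comment> \<open>This is the \<open>i\<close>-th partial derivative at the origin of the
    numerator of \<open>r_fun\<close>, and \<open>g\<close> is that numerator's value there.\<close>
  define c where "c i = (\<xi> \<bullet> (S *v (A i *v u))) * (v \<bullet> \<eta>) + (\<xi> \<bullet> u) * (v \<bullet> (A i *v (S *v \<eta>)))" for i
  have grad_r: "gradient (r_fun \<xi> A B \<eta>) 0 = (\<chi> i. c i / g)"
  proof (rule gradient_eqI)
    let ?D = "\<lambda>h. \<Sum>i\<in>UNIV. h $ i *\<^sub>R A i"
    have "((\<lambda>t. (\<xi> \<bullet> pf_right (tilted_mat A B t)) * (pf_left (tilted_mat A B t) \<bullet> \<eta>)) has_derivative
      (\<lambda>h. (\<xi> \<bullet> (S *v (?D h *v u))) * (v \<bullet> \<eta>) + (\<xi> \<bullet> u) * (v \<bullet> (?D h *v (S *v \<eta>))))) (at 0)"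
      by (rule pf_projection_has_derivative(2)[OF tilted_mat_has_derivative primt])
        (simp_all add: tilted_mat_0 u_def v_def S[unfolded u_def v_def r_def] flip: M_def)
    also have "(\<lambda>h. (\<xi> \<bullet> (S *v (?D h *v u))) * (v \<bullet> \<eta>) + (\<xi> \<bullet> u) * (v \<bullet> (?D h *v (S *v \<eta>))))
        = (\<lambda>h. \<Sum>i\<in>UNIV. h $ i * c i)"
      by (simp add: fun_eq_iff c_def mv.sum_left mv.sum_right mv.scaleR_left mv.scaleR_right inner_sum_right
          sum_distrib_left sum_distrib_right sum.distrib algebra_simps)
    finally have "((\<lambda>t. (\<xi> \<bullet> pf_right (tilted_mat A B t)) * (pf_left (tilted_mat A B t) \<bullet> \<eta>) / g)
        has_derivative (\<lambda>h. (\<Sum>i\<in>UNIV. h $ i * c i) / g)) (at 0)"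
      by (rule bounded_linear.has_derivative[OF bounded_linear_divide])
    also have "(\<lambda>t. (\<xi> \<bullet> pf_right (tilted_mat A B t)) * (pf_left (tilted_mat A B t) \<bullet> \<eta>) / g) = r_fun \<xi> A B \<eta>"
      by (simp add: fun_eq_iff r_fun_def g_def tilted_mat_0 u_def v_def flip: M_def)
    also have "(\<lambda>h. (\<Sum>i\<in>UNIV. h $ i * c i) / g) = (\<lambda>h. h \<bullet> (\<chi> i. c i / g))"
      by (simp add: fun_eq_iff inner_vec_def sum_divide_distrib)
    finally show "(r_fun \<xi> A B \<eta> has_derivative (\<lambda>h. h \<bullet> (\<chi> i. c i / g))) (at 0)" .
  qed

  \<comment> \<open>A word of positive weight forces \<open>\<xi>\<close> and \<open>\<eta>\<close>
    to be nonzero, and nonzero nonnegative vectors pair positively with the Perron-Frobenius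
    vectors.\<close>
  have "g > 0"
  proof -
    obtain w where "\<xi> \<bullet> (word_mat A B w *v \<eta>) > 0"
      using eventually_happens'[OF _ support] by auto
    then have "\<xi> \<noteq> 0" "\<eta> \<noteq> 0"
      by auto
    then have "0 < \<xi> \<bullet> u" "0 < \<eta> \<bullet> v"
      using rep vu' by (auto simp: linear_representation_def intro!: inner_nonneg_pos)
    then show ?thesis
      by (simp add: g_def inner_commute)
  qed

  \<comment> \<open>Expansion of the matrix powers acting on \<open>\<eta>\<close> and on
    \<open>\<xi>\<close>\<close>
  obtain d1 C1 q where q: "0 < d1" "d1 < 1" "0 \<le> C1"
    "\<And>k. mat_pow M k *v \<eta> = r ^ k *\<^sub>R ((v \<bullet> \<eta>) *\<^sub>R u + q k)"
    "\<And>k. norm (q k) \<le> C1 * d1 ^ k"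
    "\<And>n. norm ((\<Sum>k<n. q k) - r *\<^sub>R (S *v \<eta>)) \<le> C1 * d1 ^ n"
    using mat_pow_spectral_expansion[OF prim vu S(2), folded r_def, OF S(3), of \<eta>] by blast
  note vut = pf_vectors_transpose[OF prim vu, folded r_def]
  have S_transpose: "r *\<^sub>R (transpose S *v x) - transpose M *v (transpose S *v x) = x - (u \<bullet> x) *\<^sub>R v" for x
  proof -
    have "(r *\<^sub>R (x v* S) - (x v* S) v* M) \<bullet> z = (x - (u \<bullet> x) *\<^sub>R v) \<bullet> z" for z
    proof -
      have "(r *\<^sub>R (x v* S) - (x v* S) v* M) \<bullet> z = x \<bullet> (S *v (r *\<^sub>R z - M *v z))"
        by (simp add: dot_lmul_matrix inner_diff_left inner_diff_right mv.diff_right mv.scaleR_right)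
      also have "\<dots> = (x - (u \<bullet> x) *\<^sub>R v) \<bullet> z"
        unfolding S by (simp add: inner_diff_left inner_diff_right inner_commute)
      finally show ?thesis .
    qed
    then have "r *\<^sub>R (x v* S) - (x v* S) v* M = x - (u \<bullet> x) *\<^sub>R v"
      using vector_eq_rdot by blast
    then show ?thesis by simp
  qed
  \<comment> \<open>The row vectors \<open>\<xi>' M^k\<close> are expanded by applying the column
    version to the transpose, whose left and right eigenvectors are \<open>u\<close> and
    \<open>v\<close> and whose reduced resolvent is \<open>transpose S\<close>.\<close>
  obtain d2 C2 p where p: "0 < d2" "d2 < 1" "0 \<le> C2"
    "\<And>k. \<xi> v* mat_pow M k = r ^ k *\<^sub>R ((\<xi> \<bullet> u) *\<^sub>R v + p k)"
    "\<And>k. norm (p k) \<le> C2 * d2 ^ k"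
    "\<And>n. norm ((\<Sum>k<n. p k) - r *\<^sub>R (\<xi> v* S)) \<le> C2 * d2 ^ n"
  proof -
    have "u v* transpose S = 0"
      by (simp add: S)
    from mat_pow_spectral_expansion[OF primitive_mat_transpose[OF prim] vut(2) this, unfolded vut(1), OF S_transpose, of \<xi>]
    show ?thesis
      by (simp add: mat_pow_transpose inner_commute[of u]) (use that in blast)
  qed
  define d where "d = max d1 d2"
  define C where "C = max C1 C2"
  \<comment> \<open>The midpoint between \<open>d\<close> and 1 leaves room to absorb the linear
    factor in \<open>n\<close>.\<close>
  define e where "e = (1 + d) / 2"
  have d: "0 < d" "d < 1" "d < e" "0 < e" "e < 1" and C: "0 \<le> C"
    using p q by (auto simp: d_def e_def C_def)
  have le: "C1 * d1 ^ k \<le> C * d ^ k" "C2 * d2 ^ k \<le> C * d ^ k" for k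
    using p(1,3) q(1,3) by (auto simp: d_def C_def intro!: mult_mono power_mono)
  have pd: "norm (p k) \<le> C * d ^ k" "norm ((\<Sum>k<n. p k) - r *\<^sub>R (\<xi> v* S)) \<le> C * d ^ n"
    and qd: "norm (q k) \<le> C * d ^ k" "norm ((\<Sum>k<n. q k) - r *\<^sub>R (S *v \<eta>)) \<le> C * d ^ n" for k n
    using p(5,6) q(5,6) le order_trans by blast+

  have denom: "(\<lambda>n. (\<xi> \<bullet> (mat_pow M n *v \<eta>)) / r ^ n - g) \<in> O(\<lambda>n. d ^ n)"
  proof (rule bigoI[of _ "norm \<xi> * C"], intro always_eventually allI)
    fix n
    have "(\<xi> \<bullet> (mat_pow M n *v \<eta>)) / r ^ n - g = \<xi> \<bullet> q n"
      using r by (simp add: q(4) g_def inner_add_right algebra_simps add_divide_distrib)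
    also have "norm \<dots> \<le> norm \<xi> * (C * d ^ n)"
      by (metis Cauchy_Schwarz_ineq2 mult_left_mono norm_ge_zero order_trans qd(1) real_norm_def)
    finally show "norm ((\<xi> \<bullet> (mat_pow M n *v \<eta>)) / r ^ n - g) \<le> norm \<xi> * C * norm (d ^ n)"
      using d by simp
  qed

  \<comment> \<open>Asymptotics of each component of the mean\<close>
  have mean: "(\<lambda>n. mean_counts \<xi> A B \<eta> n $ i - (real n * (v \<bullet> (A i *v u) / r) + c i / g)) \<in> O(\<lambda>n. e ^ n)" for i
  proof -
    \<comment> \<open>The two powers in a summand have total exponent \<open>n - 1\<close>, so
      normalising by \<open>r ^ n\<close> leaves one factor \<open>1 / r\<close>, which is built
      into \<open>h\<close>.\<close>
    define h where "h x y = (x \<bullet> (A i *v y)) / r" for x y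
    have h: "bounded_bilinear h"
    proof -
      have "bounded_bilinear (\<lambda>x y. x \<bullet> (A i *v y))"
        by (rule bounded_bilinear.comp[OF bounded_bilinear_inner bounded_linear_ident matrix_vector_mul_bounded_linear])
      then show ?thesis
        unfolding bilinear_conv_bounded_bilinear[symmetric] h_def[abs_def]
        by (auto simp: bilinear_def linear_iff add_divide_distrib)
    qed
    define f where "f n = (\<Sum>k<n. \<xi> \<bullet> (mat_pow M k *v (A i *v (mat_pow M (n - Suc k) *v \<eta>)))) / r ^ n" for n
    have f: "f n = (\<Sum>k<n. h ((\<xi> \<bullet> u) *\<^sub>R v + p k) ((v \<bullet> \<eta>) *\<^sub>R u + q (n - Suc k)))" for n
      unfolding f_def sum_divide_distrib
    proof (intro sum.cong refl)
      fix k assume "k \<in> {..<n}"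
      then have rn: "r ^ n = r ^ k * r ^ (n - Suc k) * r"
        by (simp flip: power_add power_Suc2)
      have "\<xi> \<bullet> (mat_pow M k *v (A i *v (mat_pow M (n - Suc k) *v \<eta>)))
          = (\<xi> v* mat_pow M k) \<bullet> (A i *v (mat_pow M (n - Suc k) *v \<eta>))"
        by (simp only: dot_lmul_matrix)
      also have "\<dots> = r ^ k * r ^ (n - Suc k) * (((\<xi> \<bullet> u) *\<^sub>R v + p k) \<bullet> (A i *v ((v \<bullet> \<eta>) *\<^sub>R u + q (n - Suc k))))"
        by (simp only: p(4) q(4) mv.scaleR_right inner_scaleR_left inner_scaleR_right mult_ac)
      finally show "\<xi> \<bullet> (mat_pow M k *v (A i *v (mat_pow M (n - Suc k) *v \<eta>))) / r ^ n
          = h ((\<xi> \<bullet> u) *\<^sub>R v + p k) ((v \<bullet> \<eta>) *\<^sub>R u + q (n - Suc k))"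
        using r by (simp add: h_def rn)
    qed
    have "(\<lambda>n. f n - (real n * h ((\<xi> \<bullet> u) *\<^sub>R v) ((v \<bullet> \<eta>) *\<^sub>R u)
        + h ((\<xi> \<bullet> u) *\<^sub>R v) (r *\<^sub>R (S *v \<eta>)) + h (r *\<^sub>R (\<xi> v* S)) ((v \<bullet> \<eta>) *\<^sub>R u)))
      \<in> O(\<lambda>n. real (Suc n) * d ^ n)"
      unfolding f by (rule bilinear_convolution_asymptotics[OF h d(1) C pd qd])
    moreover have "h ((\<xi> \<bullet> u) *\<^sub>R v) ((v \<bullet> \<eta>) *\<^sub>R u) = v \<bullet> (A i *v u) / r * g"
      by (simp add: h_def g_def mv.scaleR_right)
    \<comment> \<open>The factor \<open>r\<close> in the limits of the remainder sums cancels the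
      \<open>1 / r\<close> in \<open>h\<close>, leaving exactly the derivative found for
      \<open>r_fun\<close>.\<close>
    moreover have "h ((\<xi> \<bullet> u) *\<^sub>R v) (r *\<^sub>R (S *v \<eta>)) + h (r *\<^sub>R (\<xi> v* S)) ((v \<bullet> \<eta>) *\<^sub>R u) = c i"
      using r by (simp add: h_def c_def mv.scaleR_right dot_lmul_matrix)
    ultimately have "(\<lambda>n. f n - (real n * (v \<bullet> (A i *v u) / r * g) + c i)) \<in> O(\<lambda>n. real (Suc n) * d ^ n)"
      by (simp add: add.assoc)
    from ratio_affine_asymptotics[OF this denom _ d(1,3,2)] \<open>g > 0\<close>
    have "(\<lambda>n. f n / (\<xi> \<bullet> (mat_pow M n *v \<eta>) / r ^ n) - (real n * (v \<bullet> (A i *v u) / r) + c i / g)) \<in> O(\<lambda>n. e ^ n)"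
      by simp
    moreover have "mean_counts \<xi> A B \<eta> n $ i = f n / (\<xi> \<bullet> (mat_pow M n *v \<eta>) / r ^ n)" for n
      using r by (simp add: mean_counts_eq[OF rep] f_def M_def)
    ultimately show ?thesis
      by simp
  qed

  \<comment> \<open>From components to the norm\<close>
  let ?err = "\<lambda>n. mean_counts \<xi> A B \<eta> n - (real n *\<^sub>R (gradient (y_fun A B) 0 /\<^sub>R r) + gradient (r_fun \<xi> A B \<eta>) 0)"
  have "(\<lambda>n. \<Sum>i\<in>UNIV. \<bar>?err n $ i\<bar>) \<in> O(\<lambda>n. e ^ n)"
  proof (rule big_sum_in_bigo)
    show "(\<lambda>n. \<bar>?err n $ i\<bar>) \<in> O(\<lambda>n. e ^ n)" for i
      using mean[of i] by (simp add: grad_y grad_r divide_inverse mult_ac)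
  qed
  moreover have "(\<lambda>n. norm (?err n)) \<in> O(\<lambda>n. \<Sum>i\<in>UNIV. \<bar>?err n $ i\<bar>)"
  proof (intro landau_o.big_mono always_eventually allI)
    have "norm x \<le> norm (\<Sum>i\<in>UNIV. \<bar>x $ i\<bar>)" for x :: "real ^ 'l"
      using norm_le_l1_cart[of x] by (simp add: sum_nonneg)
    then show "norm (norm (?err n)) \<le> norm (\<Sum>i\<in>UNIV. \<bar>?err n $ i\<bar>)" for n
      by (simp only: real_norm_def abs_norm_cancel)
  qed
  ultimately have "(\<lambda>n. norm (?err n)) \<in> O(\<lambda>n. e ^ n)"
    using landau_o.big.trans by blast
  then show ?thesis
    unfolding Let_def using d(4,5) by (auto simp: r_def M_def)
qed

end
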